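(* Let $\Omega=[0,1)$ with Lebesgue measure $\mathbb P$ and let $p(\cdot):[0,1)\to(0,\infty)$ be measurable with $p_-=\operatorname{ess\,inf}p$, $p_+=\operatorname{ess\,sup}p$, $0<p_-\le p_+<\infty$. Assume that there is a constant $K\ge 1$ such that $\mathbb P(A)^{p_-(A)-p_+(A)}\le K$ for every dyadic interval $A\subset[0,1)$, and that $\frac1{p_-}-\frac1{p_+}<1$. If $1/2<p_-<\infty$ and $f\in H_{p(\cdot)}$, then $\sigma_nf$ converges almost everywhere on $[0,1)$ as $n\to\infty$.
   Context: For measurable $A\subset[0,1)$, $p_-(A)=\operatorname{ess\,inf}_{x\in A}p(x)$ and $p_+(A)=\operatorname{ess\,sup}_{x\in A}p(x)$. $\|f\|_{p(\cdot)}=\inf\{\lambda>0:\int_0^1(|f(x)|/\lambda)^{p(x)}dx\le1\}$. Dyadic intervals are $[k2^{-n},(k+1)2^{-n})$, $n\in\mathbb N=\{0,1,2,\dots\}$, $0\le k<2^n$; $\mathcal F_n$ is the $\sigma$-algebra generated by the dyadic intervals of length $2^{-n}$. Martingales $f=(f_n)_{n\ge0}$ are taken with respect to $(\mathcal F_n)$. $M(f)=\sup_{n\ge0}|f_n|$. $H_{p(\cdot)}$ is the space of martingales with $\|f\|_{H_{p(\cdot)}}=\|M(f)\|_{p(\cdot)}<\infty$ (the paper uses this notation for any of five martingale Hardy spaces, which coincide with equivalent quasi-norms in the dyadic setting; this is one of them). Walsh system: $r(x)=1$ on $[0,1/2)$, $r(x)=-1$ on $[1/2,1)$, extended with period 1;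 $r_n(x)=r(2^nx)$; for $n=\sum_{k\ge0}n_k2^k$ with $n_k\in\{0,1\}$, $w_n=\prod_{k\ge0}r_k^{n_k}$. For a martingale $f$, $\widehat f(n)=\lim_{k\to\infty}\mathbb E(f_kw_n)$ (the sequence is eventually constant). Partial sums: $s_nf=\sum_{k=0}^{n-1}\widehat f(k)w_k$. Fejér means: $\sigma_nf=\frac1n\sum_{k=1}^ns_kf$, $n\ge1$. *)

theory Defs
  imports "HOL-Probability.Essential_Supremum" "HOL-Probability.Conditional_Expectation"
begin

text \<open>Functions on \<open>[0,1)\<close> are modelled as functions on all reals; only their values on
  \<open>{0..<1}\<close>, the space of the following probability measure, are ever used.\<close>

definition unit_leb :: "real measure" where
  "unit_leb = lebesgue_on {0..<1}"

definition essinf :: "'a measure \<Rightarrow> ('a \<Rightarrow> ereal) \<Rightarrow> ereal" where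
  "essinf M f = Sup {z. AE x in M. z \<le> f x}"

definition p_minus :: "(real \<Rightarrow> real) \<Rightarrow> real set \<Rightarrow> ereal" where
  "p_minus p A = essinf (restrict_space unit_leb A) (\<lambda>x. ereal (p x))"

definition p_plus :: "(real \<Rightarrow> real) \<Rightarrow> real set \<Rightarrow> ereal" where
  "p_plus p A = esssup (restrict_space unit_leb A) (\<lambda>x. ereal (p x))"

text \<open>The power \<open>x\<^sup>a\<close> of an extended nonnegative number, for exponents \<open>a > 0\<close> only
  (hence \<open>\<infinity>\<^sup>a = \<infinity>\<close>).\<close>

definition ennreal_powr :: "ennreal \<Rightarrow> real \<Rightarrow> ennreal" where
  "ennreal_powr x a = (if x = top then top else ennreal (enn2real x powr a))"

text \<open>The variable Lebesgue quasi-norm of a nonnegative function. Values in \<open>[0,\<infinity>]\<close> are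
  admitted because a maximal function may be infinite at some points; the norm is \<open>\<infinity>\<close> if no
  \<open>\<lambda>\<close> is admissible.\<close>

definition var_norm :: "(real \<Rightarrow> real) \<Rightarrow> (real \<Rightarrow> ennreal) \<Rightarrow> ennreal" where
  "var_norm p g =
     Inf {l. 0 < l \<and> l < top \<and> (\<integral>\<^sup>+ x. ennreal_powr (g x / l) (p x) \<partial>unit_leb) \<le> 1}"

definition dyadic_interval :: "nat \<Rightarrow> nat \<Rightarrow> real set" where
  "dyadic_interval n k = {real k / 2 ^ n ..< (real k + 1) / 2 ^ n}"

definition dyadic_algebra :: "nat \<Rightarrow> real measure" where
  "dyadic_algebra n = sigma {0..<1} {dyadic_interval n k | k. k < 2 ^ n}"

definition dyadic_martingale :: "(nat \<Rightarrow> real \<Rightarrow> real) \<Rightarrow> bool" where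
  "dyadic_martingale f \<longleftrightarrow>
     (\<forall>n. f n \<in> borel_measurable (dyadic_algebra n) \<and> integrable unit_leb (f n)) \<and>
     (\<forall>m n. m \<le> n \<longrightarrow> (AE x in unit_leb. real_cond_exp unit_leb (dyadic_algebra m) (f n) x = f m x))"

definition maximal_function :: "(nat \<Rightarrow> real \<Rightarrow> real) \<Rightarrow> real \<Rightarrow> ennreal" where
  "maximal_function f x = (SUP n. ennreal \<bar>f n x\<bar>)"

definition hardy_space :: "(real \<Rightarrow> real) \<Rightarrow> (nat \<Rightarrow> real \<Rightarrow> real) set" where
  "hardy_space p = {f. dyadic_martingale f \<and> var_norm p (maximal_function f) < top}"

definition rademacher :: "nat \<Rightarrow> real \<Rightarrow> real" where
  "rademacher n x = (if frac (2 ^ n * x) < 1 / 2 then 1 else - 1)"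

text \<open>The \<open>k\<close>-th binary digit of \<open>n\<close> is 1 iff \<open>bit n k\<close>, and there are finitely many such \<open>k\<close>.\<close>

definition walsh :: "nat \<Rightarrow> real \<Rightarrow> real" where
  "walsh n x = (\<Prod>k\<in>{k. bit n k}. rademacher k x)"

definition walsh_coeff :: "(nat \<Rightarrow> real \<Rightarrow> real) \<Rightarrow> nat \<Rightarrow> real" where
  "walsh_coeff f n = lim (\<lambda>k. \<integral>x. f k x * walsh n x \<partial>unit_leb)"

definition walsh_partial_sum :: "(nat \<Rightarrow> real \<Rightarrow> real) \<Rightarrow> nat \<Rightarrow> real \<Rightarrow> real" where
  "walsh_partial_sum f n x = (\<Sum>k<n. walsh_coeff f k * walsh k x)"

definition fejer_mean :: "(nat \<Rightarrow> real \<Rightarrow> real) \<Rightarrow> nat \<Rightarrow> real \<Rightarrow> real" where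
  "fejer_mean f n x = (\<Sum>k=1..n. walsh_partial_sum f k x) / real n"

end

theory Submission
  imports Defs
begin

text \<open>
  Only one consequence of the hypotheses on the exponent matters: some constant \<open>q\<close> with
  \<open>1/2 < q \<le> 1\<close> lies below \<open>p\<close> almost everywhere. As \<open>y\<^sup>q \<le> 1 + y\<^sup>p\<close> for \<open>p \<ge> q\<close>, the maximal
  function of \<open>f\<close> has an integrable \<open>q\<close>-th power, and it suffices to prove the result for the
  classical Hardy space with constant exponent \<open>q\<close> (\<open>AE_convergent_fejer_mean\<close>).

  There the proof is a density argument. Let \<open>h\<^sub>J = f - f\<^sup>J\<close>, where \<open>f\<^sup>J\<close> is \<open>f\<close> frozen at time \<open>J\<close>.
  The martingale \<open>f\<^sup>J\<close> is a Walsh polynomial, whose Fejer means converge everywhere, so the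
  oscillation of the Fejer means of \<open>f\<close> is at most twice the supremum of those of \<open>h\<^sub>J\<close>. The latter is
  controlled by the weak type inequality (\<open>fejer_weak_type\<close>)
  \<open>P(sup\<^sub>n |\<sigma>\<^sub>n h| > 5 e) \<le> C\<^sub>q e\<^bsup>-q\<^esup> E (sup\<^sub>n |h\<^sub>n|\<^sup>q)\<close>
  for martingales \<open>h\<close> with \<open>h\<^sub>0 = 0\<close>, and its right-hand side tends to 0 for \<open>h = h\<^sub>J\<close> by dominated
  convergence, since \<open>f\<^sub>n\<close> converges almost everywhere. The convergence of \<open>f\<^sub>n\<close> follows from an
  \<open>L\<^sup>2\<close> maximal inequality (\<open>maximal_L2\<close>) for the martingale stopped before it exceeds a bound.

  The weak type inequality rests on an atomic decomposition. Stopping \<open>h\<close> just before \<open>|h|\<close> exceeds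
  \<open>e 2\<^sup>k\<close> gives martingales bounded by \<open>e 2\<^sup>k\<close>. The one for \<open>k = 0\<close> has Fejer means bounded by \<open>4 e\<close>,
  because the Fejer kernels are bounded in \<open>L\<^sup>1\<close>. The difference of two consecutive ones is a sum of
  atoms: functions bounded by \<open>3 e 2\<^sup>k\<close>, of mean zero, each supported in one dyadic interval on which
  \<open>h\<close> is stopped at level \<open>k\<close>. Off its interval \<open>I\<close>, all Fejer means of an atom of height 1 are bounded by
  a function \<open>G\<^sub>I\<close> (\<open>fejer_atom\<close>) with \<open>E G\<^sub>I\<^sup>q \<le> C\<^sub>q |I|\<close> (\<open>grid_mean_atom_bound\<close>); this is where
  \<open>q > 1/2\<close> is needed. Subadditivity of \<open>y \<mapsto> y\<^sup>q\<close> and a geometric sum over \<open>k\<close> conclude.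

  The kernel estimates use the recursions for \<open>D\<^bsub>2^a\<^esub>\<close> and \<open>Q\<^sub>a = 2\<^sup>a K\<^bsub>2^a\<^esub> = \<Sum>\<^bsub>1\<le>k\<le>2^a\<^esub> D\<^sub>k\<close>, namely
  \<open>D\<^bsub>2^(a+1)\<^esub> = (1 + R\<^sub>a) D\<^bsub>2^a\<^esub>\<close> and \<open>Q\<^bsub>a+1\<^esub> = (1 + R\<^sub>a) Q\<^sub>a + 2\<^sup>a D\<^bsub>2^a\<^esub>\<close>, where \<open>R\<^sub>a(x,t) = r\<^sub>a(x) r\<^sub>a(t)\<close> is
  independent of the first \<open>a\<close> binary digits and \<open>1 + R\<^sub>a\<close> takes the values 0 and 2. In particular
  \<open>Q\<^sub>a \<ge> 0\<close>. Kernels are kept as functions of the two variables \<open>x\<close> and \<open>t\<close>, which makes dyadic addition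
  unnecessary.

  Every estimate concerns functions that are constant on dyadic intervals of a fixed level \<open>N\<close>, so it is
  proved with the finite average \<open>grid_mean N\<close> over left endpoints in place of the integral; measure theory
  enters only in the limit \<open>N \<rightarrow> \<infinity>\<close>.
\<close>


section \<open>Step functions on dyadic intervals and their averages\<close>

text \<open>\<open>g\<close> is constant on each dyadic interval of length \<open>2\<^bsup>-n\<^esup>\<close>. Two points of \<open>[0,1)\<close> lie in the same
  such interval iff \<open>\<lfloor>2\<^sup>n x\<rfloor>\<close> takes the same value at both. The range is arbitrary, so that the notion
  also covers predicates.\<close>

definition dyadic_step :: "nat \<Rightarrow> (real \<Rightarrow> 'a) \<Rightarrow> bool" where
  "dyadic_step n g \<longleftrightarrow> (\<forall>x\<in>{0..<1}. \<forall>y\<in>{0..<1}. \<lfloor>2 ^ n * x\<rfloor> = \<lfloor>2 ^ n * y\<rfloor> \<longrightarrow> g x = g y)"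

text \<open>The left endpoints of the dyadic intervals of length \<open>2\<^bsup>-n\<^esup>\<close>; they also serve as names of these
  intervals.\<close>

definition grid :: "nat \<Rightarrow> real set" where
  "grid n = (\<lambda>k. real k / 2 ^ n) ` {..<2 ^ n}"

text \<open>The average over these endpoints; for level-\<open>n\<close> step functions it is the integral over \<open>[0,1)\<close>.\<close>

definition grid_mean :: "nat \<Rightarrow> (real \<Rightarrow> real) \<Rightarrow> real" where
  "grid_mean n g = (\<Sum>x\<in>grid n. g x) / 2 ^ n"

lemma dyadic_stepD:
  "dyadic_step n g \<Longrightarrow> x \<in> {0..<1} \<Longrightarrow> y \<in> {0..<1} \<Longrightarrow> \<lfloor>2 ^ n * x\<rfloor> = \<lfloor>2 ^ n * y\<rfloor> \<Longrightarrow> g x = g y"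
  unfolding dyadic_step_def by blast

lemma floor_pow2_Suc: "\<lfloor>2 ^ n * (x::real)\<rfloor> = \<lfloor>2 ^ Suc n * x\<rfloor> div 2"
  using floor_divide_real_eq_div[of 2 "2 ^ Suc n * x"] by simp

lemma same_cell_mono:
  fixes x y :: real
  assumes "\<lfloor>2 ^ m * (x::real)\<rfloor> = \<lfloor>2 ^ m * y\<rfloor>" "n \<le> m"
  shows "\<lfloor>2 ^ n * x\<rfloor> = \<lfloor>2 ^ n * y\<rfloor>"
  using assms(2,1)
proof (induction rule: dec_induct)
  case (step k)
  then show ?case using floor_pow2_Suc[of k x] floor_pow2_Suc[of k y] by simp
qed simp

lemma dyadic_step_mono: "dyadic_step n g \<Longrightarrow> n \<le> m \<Longrightarrow> dyadic_step m g"
  unfolding dyadic_step_def using same_cell_mono by blast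

lemma dyadic_step_const [simp]: "dyadic_step n (\<lambda>x. c)"
  by (simp add: dyadic_step_def)

lemma dyadic_step_comp: "dyadic_step n g \<Longrightarrow> dyadic_step n (\<lambda>x. F (g x))"
  unfolding dyadic_step_def by metis

lemma dyadic_step_comp2:
  "dyadic_step n g \<Longrightarrow> dyadic_step n h \<Longrightarrow> dyadic_step n (\<lambda>x. F (g x) (h x))"
  unfolding dyadic_step_def by metis

lemma dyadic_step_sum:
  "(\<And>i. i \<in> A \<Longrightarrow> dyadic_step n (g i)) \<Longrightarrow> dyadic_step n (\<lambda>x. \<Sum>i\<in>A. g i x :: real)"
  unfolding dyadic_step_def by (intro ballI impI sum.cong refl) metis

lemma dyadic_step_prod:
  "(\<And>i. i \<in> A \<Longrightarrow> dyadic_step n (g i)) \<Longrightarrow> dyadic_step n (\<lambda>x. \<Prod>i\<in>A. g i x :: real)"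
  unfolding dyadic_step_def by (intro ballI impI prod.cong refl) metis

lemma dyadic_step_cell: "dyadic_step n (\<lambda>x. \<lfloor>2 ^ n * x\<rfloor>)"
  by (simp add: dyadic_step_def)

lemma inj_grid: "inj_on (\<lambda>k. real k / 2 ^ n) A"
  by (auto simp: inj_on_def)

lemma finite_grid [simp]: "finite (grid n)"
  by (simp add: grid_def)

lemma card_grid [simp]: "card (grid n) = 2 ^ n"
  by (simp add: grid_def card_image[OF inj_grid])

lemma grid_unit: "x \<in> grid n \<Longrightarrow> x \<in> {0..<1}"
proof -
  assume "x \<in> grid n"
  then obtain k where k: "k < 2 ^ n" "x = real k / 2 ^ n" by (auto simp: grid_def)
  have "real k < 2 ^ n" using k(1) by (metis of_nat_less_iff of_nat_numeral of_nat_power)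
  then show ?thesis by (simp add: k(2))
qed

lemma grid_floor: "x \<in> grid n \<Longrightarrow> 2 ^ n * x = of_int \<lfloor>2 ^ n * x\<rfloor>"
  by (auto simp: grid_def)

lemma grid_inj: "x \<in> grid n \<Longrightarrow> y \<in> grid n \<Longrightarrow> \<lfloor>2 ^ n * x\<rfloor> = \<lfloor>2 ^ n * y\<rfloor> \<Longrightarrow> x = y"
  using grid_floor[of x n] grid_floor[of y n] by simp

lemma grid_half:
  assumes "x \<in> grid n"
  shows "x + 1 / 2 ^ Suc n \<in> {0..<1}" "\<lfloor>2 ^ n * (x + 1 / 2 ^ Suc n)\<rfloor> = \<lfloor>2 ^ n * x\<rfloor>"
    "\<lfloor>2 ^ Suc n * x\<rfloor> = 2 * \<lfloor>2 ^ n * x\<rfloor>"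
    "\<lfloor>2 ^ Suc n * (x + 1 / 2 ^ Suc n)\<rfloor> = 2 * \<lfloor>2 ^ n * x\<rfloor> + 1"
proof -
  obtain k where k: "k < 2 ^ n" "x = real k / 2 ^ n" using assms by (auto simp: grid_def)
  have "Suc k \<le> 2 ^ n" using k(1) by simp
  then have "real (Suc k) \<le> 2 ^ n" by (metis of_nat_le_iff of_nat_numeral of_nat_power)
  then show "x + 1 / 2 ^ Suc n \<in> {0..<1}" by (simp add: k(2) field_simps)
  have e: "\<lfloor>2 ^ n * x\<rfloor> = int k" by (simp add: k(2))
  have "2 ^ n * (x + 1 / 2 ^ Suc n) = real k + 1 / 2" by (simp add: k(2) field_simps)
  then show "\<lfloor>2 ^ n * (x + 1 / 2 ^ Suc n)\<rfloor> = \<lfloor>2 ^ n * x\<rfloor>" unfolding e by (simp add: floor_eq_iff)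
  have "2 ^ Suc n * x = of_int (2 * int k)" by (simp add: k(2))
  then show "\<lfloor>2 ^ Suc n * x\<rfloor> = 2 * \<lfloor>2 ^ n * x\<rfloor>" unfolding e by (metis floor_of_int)
  have "2 ^ Suc n * (x + 1 / 2 ^ Suc n) = of_int (2 * int k + 1)" by (simp add: k(2) field_simps)
  then show "\<lfloor>2 ^ Suc n * (x + 1 / 2 ^ Suc n)\<rfloor> = 2 * \<lfloor>2 ^ n * x\<rfloor> + 1"
    unfolding e by (metis floor_of_int)
qed

lemma unit_grid:
  assumes "x \<in> {0..<1}"
  obtains c where "c \<in> grid n" "\<lfloor>2 ^ n * c\<rfloor> = \<lfloor>2 ^ n * x\<rfloor>"
proof -
  define k where "k = nat \<lfloor>2 ^ n * x\<rfloor>"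
  have k: "int k = \<lfloor>2 ^ n * x\<rfloor>" using assms by (simp add: k_def)
  have "2 ^ n * x < 2 ^ n" using assms by simp
  then have "\<lfloor>2 ^ n * x\<rfloor> < 2 ^ n" by (simp add: floor_less_iff)
  then have "int k < int (2 ^ n)" using k by simp
  then have "k < 2 ^ n" by (simp only: of_nat_less_iff)
  then show ?thesis using that[of "real k / 2 ^ n"] k by (auto simp: grid_def)
qed

lemma unit_half_cases:
  fixes c x :: real
  assumes "c \<in> grid n" "\<lfloor>2 ^ n * c\<rfloor> = \<lfloor>2 ^ n * x\<rfloor>"
  shows "\<lfloor>2 ^ Suc n * x\<rfloor> = \<lfloor>2 ^ Suc n * c\<rfloor> \<or> \<lfloor>2 ^ Suc n * x\<rfloor> = \<lfloor>2 ^ Suc n * (c + 1 / 2 ^ Suc n)\<rfloor>"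
  using grid_half(3,4)[OF assms(1)] floor_pow2_Suc[of n x] assms(2) by linarith

lemma grid_mean_cong: "(\<And>x. x \<in> grid n \<Longrightarrow> g x = h x) \<Longrightarrow> grid_mean n g = grid_mean n h"
  unfolding grid_mean_def by (metis sum.cong)

lemma grid_mean_mono: "(\<And>x. x \<in> grid n \<Longrightarrow> g x \<le> h x) \<Longrightarrow> grid_mean n g \<le> grid_mean n h"
  unfolding grid_mean_def by (intro divide_right_mono sum_mono) auto

lemma grid_mean_nonneg: "(\<And>x. x \<in> grid n \<Longrightarrow> 0 \<le> h x) \<Longrightarrow> 0 \<le> grid_mean n h"
  unfolding grid_mean_def by (intro divide_nonneg_nonneg sum_nonneg) auto

lemma grid_mean_const [simp]: "grid_mean n (\<lambda>x. c) = c"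
  by (simp add: grid_mean_def)

lemma grid_mean_add: "grid_mean n (\<lambda>x. g x + h x) = grid_mean n g + grid_mean n h"
  by (simp add: grid_mean_def sum.distrib add_divide_distrib)

lemma grid_mean_diff: "grid_mean n (\<lambda>x. g x - h x) = grid_mean n g - grid_mean n h"
  by (simp add: grid_mean_def sum_subtractf diff_divide_distrib)

lemma grid_mean_cmult: "grid_mean n (\<lambda>x. c * g x) = c * grid_mean n g"
  by (simp add: grid_mean_def sum_distrib_left)

lemma grid_mean_sum: "grid_mean n (\<lambda>x. \<Sum>i\<in>A. g i x) = (\<Sum>i\<in>A. grid_mean n (g i))"
  unfolding grid_mean_def sum_divide_distrib by (rule sum.swap)

lemma grid_mean_abs: "\<bar>grid_mean n g\<bar> \<le> grid_mean n (\<lambda>x. \<bar>g x\<bar>)"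
  unfolding grid_mean_def by (simp add: divide_right_mono)

text \<open>The two halves of the interval at \<open>x\<close> have left endpoints \<open>x\<close> and \<open>x + 2\<^bsup>-n-1\<^esup>\<close>.\<close>

lemma grid_mean_Suc: "grid_mean (Suc n) g = grid_mean n (\<lambda>x. (g x + g (x + 1 / 2 ^ Suc n)) / 2)"
proof -
  have s: "(\<Sum>k<2 * M. F k) = (\<Sum>k<M. F (2 * k) + F (Suc (2 * k)))" for M and F :: "nat \<Rightarrow> real"
    by (induction M) (auto simp: algebra_simps)
  have "(\<Sum>x\<in>grid (Suc n). g x) = (\<Sum>k<2 * 2 ^ n. g (real k / 2 ^ Suc n))"
    unfolding grid_def sum.reindex[OF inj_grid] by simp
  also have "\<dots> = (\<Sum>k<2 ^ n. g (real k / 2 ^ n) + g (real k / 2 ^ n + 1 / 2 ^ Suc n))"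
    unfolding s by (intro sum.cong refl arg_cong2[of _ _ _ _ "(+)"] arg_cong[of _ _ g])
      (simp_all add: field_simps)
  also have "\<dots> = (\<Sum>x\<in>grid n. g x + g (x + 1 / 2 ^ Suc n))"
    by (simp add: grid_def sum.reindex[OF inj_grid])
  finally show ?thesis by (simp add: grid_mean_def sum_divide_distrib[symmetric])
qed

lemma grid_mean_step:
  assumes "dyadic_step n g" "n \<le> N"
  shows "grid_mean N g = grid_mean n g"
  using assms(2)
proof (induction rule: dec_induct)
  case (step k)
  have "grid_mean (Suc k) g = grid_mean k g"
    unfolding grid_mean_Suc
  proof (rule grid_mean_cong)
    fix x assume x: "x \<in> grid k"
    have "g (x + 1 / 2 ^ Suc k) = g x"
      using dyadic_stepD[OF dyadic_step_mono[OF assms(1) step(1)] grid_half(1)[OF x] grid_unit[OF x]]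
        grid_half(2)[OF x] by blast
    then show "(g x + g (x + 1 / 2 ^ Suc k)) / 2 = g x" by simp
  qed
  then show ?case using step by simp
qed simp

lemma grid_mean_cell:
  assumes "c \<in> grid n" "n \<le> N"
  shows "grid_mean N (\<lambda>x. of_bool (\<lfloor>2 ^ n * x\<rfloor> = \<lfloor>2 ^ n * c\<rfloor>)) = 1 / 2 ^ n"
proof -
  have "grid_mean N (\<lambda>x. of_bool (\<lfloor>2 ^ n * x\<rfloor> = \<lfloor>2 ^ n * c\<rfloor>)) = grid_mean n (\<lambda>x. of_bool (\<lfloor>2 ^ n * x\<rfloor> = \<lfloor>2 ^ n * c\<rfloor>))"
    by (rule grid_mean_step[OF dyadic_step_comp[OF dyadic_step_cell] assms(2)])
  also have "\<dots> = grid_mean n (\<lambda>x. if x = c then 1 else 0)"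
    by (rule grid_mean_cong) (use assms(1) grid_inj in auto)
  also have "\<dots> = 1 / 2 ^ n" using assms(1) by (simp add: grid_mean_def)
  finally show ?thesis .
qed

section \<open>Dyadic martingales and martingale transforms\<close>

text \<open>A dyadic martingale in pointwise form: the value on an interval is the average of the values on its
  two halves.\<close>

definition tree_martingale :: "(nat \<Rightarrow> real \<Rightarrow> real) \<Rightarrow> bool" where
  "tree_martingale h \<longleftrightarrow> (\<forall>n. dyadic_step n (h n)) \<and>
     (\<forall>n. \<forall>x\<in>grid n. h (Suc n) x + h (Suc n) (x + 1 / 2 ^ Suc n) = 2 * h n x)"

lemma tree_martingale_step: "tree_martingale h \<Longrightarrow> n \<le> m \<Longrightarrow> dyadic_step m (h n)"
  unfolding tree_martingale_def using dyadic_step_mono by blast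

lemma tree_martingale_mean:
  assumes "tree_martingale h" "dyadic_step n \<phi>" "n \<le> N"
  shows "grid_mean N (\<lambda>x. \<phi> x * h N x) = grid_mean n (\<lambda>x. \<phi> x * h n x)"
  using assms(3)
proof (induction rule: dec_induct)
  case (step k)
  have "grid_mean (Suc k) (\<lambda>x. \<phi> x * h (Suc k) x) = grid_mean k (\<lambda>x. \<phi> x * h k x)"
    unfolding grid_mean_Suc
  proof (rule grid_mean_cong)
    fix x assume x: "x \<in> grid k"
    have p: "\<phi> (x + 1 / 2 ^ Suc k) = \<phi> x"
      using dyadic_stepD[OF dyadic_step_mono[OF assms(2) step(1)] grid_half(1)[OF x] grid_unit[OF x]]
        grid_half(2)[OF x] by blast
    have "h (Suc k) x + h (Suc k) (x + 1 / 2 ^ Suc k) = 2 * h k x"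
      using assms(1) x by (simp add: tree_martingale_def)
    then show "(\<phi> x * h (Suc k) x + \<phi> (x + 1 / 2 ^ Suc k) * h (Suc k) (x + 1 / 2 ^ Suc k)) / 2
        = \<phi> x * h k x"
      unfolding p by (metis distrib_left mult.left_commute nonzero_mult_div_cancel_left zero_neq_numeral)
  qed
  then show ?case using step by simp
qed simp

lemma tree_martingale_incr_mean:
  assumes "tree_martingale h" "dyadic_step n \<phi>" "n < N"
  shows "grid_mean N (\<lambda>x. \<phi> x * (h (Suc n) x - h n x)) = 0"
proof -
  have "grid_mean N (\<lambda>x. \<phi> x * (h (Suc n) x - h n x)) = grid_mean (Suc n) (\<lambda>x. \<phi> x * (h (Suc n) x - h n x))"
    by (rule grid_mean_step) (use assms tree_martingale_step[OF assms(1)] dyadic_step_mono[OF assms(2)] in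
        \<open>auto intro!: dyadic_step_comp2[of _ \<phi> _ "(*)"] dyadic_step_comp2[of _ _ _ "(-)"]\<close>)
  also have "\<dots> = grid_mean (Suc n) (\<lambda>x. \<phi> x * h (Suc n) x) - grid_mean (Suc n) (\<lambda>x. \<phi> x * h n x)"
    by (simp add: grid_mean_diff right_diff_distrib)
  also have "grid_mean (Suc n) (\<lambda>x. \<phi> x * h n x) = grid_mean n (\<lambda>x. \<phi> x * h n x)"
    by (rule grid_mean_step) (use assms tree_martingale_step[OF assms(1)] in
        \<open>auto intro!: dyadic_step_comp2[of _ \<phi> _ "(*)"]\<close>)
  also have "grid_mean (Suc n) (\<lambda>x. \<phi> x * h (Suc n) x) = grid_mean n (\<lambda>x. \<phi> x * h n x)"
    by (rule tree_martingale_mean[OF assms(1,2)]) simp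
  finally show ?thesis by simp
qed

lemma tree_martingale_incr_half:
  assumes "tree_martingale h" "x \<in> grid n"
  shows "h (Suc n) (x + 1 / 2 ^ Suc n) - h n (x + 1 / 2 ^ Suc n) = - (h (Suc n) x - h n x)"
proof -
  have "h n (x + 1 / 2 ^ Suc n) = h n x"
    using dyadic_stepD[OF tree_martingale_step[OF assms(1) order_refl] grid_half(1)[OF assms(2)] grid_unit[OF assms(2)]]
      grid_half(2)[OF assms(2)] by blast
  moreover have "h (Suc n) x + h (Suc n) (x + 1 / 2 ^ Suc n) = 2 * h n x"
    using assms by (simp add: tree_martingale_def)
  ultimately show ?thesis by simp
qed

text \<open>An increment takes opposite values on the two halves of an interval. Its absolute value is
  therefore known one step ahead, which is what allows stopping just before a threshold is exceeded.\<close>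

lemma tree_martingale_abs_incr_step:
  assumes "tree_martingale h"
  shows "dyadic_step n (\<lambda>x. \<bar>h (Suc n) x - h n x\<bar>)"
proof -
  have *: "\<bar>h (Suc n) x - h n x\<bar> = \<bar>h (Suc n) c - h n c\<bar>"
    if c: "c \<in> grid n" and e: "\<lfloor>2 ^ n * c\<rfloor> = \<lfloor>2 ^ n * x\<rfloor>" and x: "x \<in> {0..<1}" for c x
  proof -
    let ?y = "c + 1 / 2 ^ Suc n"
    have S: "dyadic_step (Suc n) (\<lambda>x. \<bar>h (Suc n) x - h n x\<bar>)"
      using tree_martingale_step[OF assms] by (auto intro!: dyadic_step_comp2[of _ _ _ "\<lambda>u v. \<bar>u - v\<bar>"])
    from unit_half_cases[OF c e] show ?thesis
    proof
      assume "\<lfloor>2 ^ Suc n * x\<rfloor> = \<lfloor>2 ^ Suc n * c\<rfloor>"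
      then show ?thesis using dyadic_stepD[OF S x grid_unit[OF c]] by blast
    next
      assume "\<lfloor>2 ^ Suc n * x\<rfloor> = \<lfloor>2 ^ Suc n * ?y\<rfloor>"
      then have "\<bar>h (Suc n) x - h n x\<bar> = \<bar>h (Suc n) ?y - h n ?y\<bar>"
        using dyadic_stepD[OF S x grid_half(1)[OF c]] by blast
      then show ?thesis using tree_martingale_incr_half[OF assms c] by simp
    qed
  qed
  show ?thesis unfolding dyadic_step_def
  proof (intro ballI impI)
    fix x y :: real assume x: "x \<in> {0..<1}" and y: "y \<in> {0..<1}" and e: "\<lfloor>2 ^ n * x\<rfloor> = \<lfloor>2 ^ n * y\<rfloor>"
    obtain c where "c \<in> grid n" "\<lfloor>2 ^ n * c\<rfloor> = \<lfloor>2 ^ n * x\<rfloor>" using unit_grid[OF x] .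
    then show "\<bar>h (Suc n) x - h n x\<bar> = \<bar>h (Suc n) y - h n y\<bar>" using *[of c x] *[of c y] x y e by simp
  qed
qed

text \<open>The martingale transform of \<open>h\<close> by \<open>v\<close>, started at 0. It is used with \<open>v i\<close> constant on intervals
  of level \<open>i\<close>.\<close>

definition mtransform :: "(nat \<Rightarrow> real \<Rightarrow> real) \<Rightarrow> (nat \<Rightarrow> real \<Rightarrow> real) \<Rightarrow> nat \<Rightarrow> real \<Rightarrow> real" where
  "mtransform v h n x = (\<Sum>i<n. v i x * (h (Suc i) x - h i x))"

lemma tree_martingale_mtransform:
  assumes h: "tree_martingale h" and v: "\<And>i. dyadic_step i (v i)"
  shows "tree_martingale (mtransform v h)"
proof -
  have st: "dyadic_step n (mtransform v h n)" for n
    unfolding mtransform_def[abs_def]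
    by (rule dyadic_step_sum)
      (use tree_martingale_step[OF h] dyadic_step_mono[OF v] in
        \<open>auto intro!: dyadic_step_comp2[of _ _ _ "(*)"] dyadic_step_comp2[of _ _ _ "(-)"]\<close>)
  moreover have "mtransform v h (Suc n) x + mtransform v h (Suc n) (x + 1 / 2 ^ Suc n) = 2 * mtransform v h n x"
    if x: "x \<in> grid n" for n x
  proof -
    have 1: "mtransform v h n (x + 1 / 2 ^ Suc n) = mtransform v h n x"
      using dyadic_stepD[OF st grid_half(1)[OF x] grid_unit[OF x]] grid_half(2)[OF x] by blast
    have 2: "v n (x + 1 / 2 ^ Suc n) = v n x"
      using dyadic_stepD[OF v grid_half(1)[OF x] grid_unit[OF x]] grid_half(2)[OF x] by blast
    have S: "mtransform v h (Suc n) z = mtransform v h n z + v n z * (h (Suc n) z - h n z)" for z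
      by (simp add: mtransform_def)
    show ?thesis unfolding S 1 2 tree_martingale_incr_half[OF h x] by (simp add: algebra_simps)
  qed
  ultimately show ?thesis unfolding tree_martingale_def by blast
qed

lemma mtransform_mean:
  assumes h: "tree_martingale h" and v: "\<And>i. dyadic_step i (v i)"
  shows "grid_mean N (mtransform v h N) = 0"
  unfolding mtransform_def[abs_def] grid_mean_sum
  by (rule sum.neutral) (auto intro!: tree_martingale_incr_mean[OF h v])

section \<open>Walsh functions and Fejer kernels\<close>

lemma rademacher_parity: "rademacher i x = (if even \<lfloor>2 ^ Suc i * x\<rfloor> then 1 else - 1)"
proof -
  define y where "y = 2 ^ i * x"
  have y: "2 ^ Suc i * x = 2 * y" by (simp add: y_def)
  have "frac y < 1 / 2 \<longleftrightarrow> even \<lfloor>2 * y\<rfloor>"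
  proof (cases "frac y < 1 / 2")
    case True
    then have "\<lfloor>2 * y\<rfloor> = 2 * \<lfloor>y\<rfloor>" unfolding frac_def by (simp add: floor_eq_iff)
    then show ?thesis using True by simp
  next
    case False
    then have "\<lfloor>2 * y\<rfloor> = 2 * \<lfloor>y\<rfloor> + 1"
      using frac_lt_1[of y] unfolding frac_def by (simp add: floor_eq_iff)
    then show ?thesis using False by simp
  qed
  then show ?thesis by (simp add: rademacher_def y[symmetric] flip: y_def)
qed

lemma rademacher_cases: "rademacher i x = 1 \<or> rademacher i x = - 1"
  by (simp add: rademacher_def)

lemma rademacher_step: "i < n \<Longrightarrow> dyadic_step n (rademacher i)"
  by (rule dyadic_step_mono[of "Suc i"])
    (simp_all add: rademacher_parity[abs_def] dyadic_step_def)

lemma rademacher_grid: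
  assumes "x \<in> grid i"
  shows "rademacher i x = 1" "rademacher i (x + 1 / 2 ^ Suc i) = - 1"
  unfolding rademacher_parity grid_half(3,4)[OF assms] by simp_all

lemma finite_bits: "finite {k. bit (n::nat) k}"
proof (rule finite_subset[of _ "{..<n}"])
  have "take_bit n n = n" by (rule take_bit_nat_eq_self) (rule less_exp)
  then show "{k. bit n k} \<subseteq> {..<n}" by (metis (no_types, lifting) bit_take_bit_iff lessThan_iff mem_Collect_eq subsetI)
qed simp

lemma walsh_step: "n < 2 ^ N \<Longrightarrow> dyadic_step N (walsh n)"
  unfolding walsh_def[abs_def]
proof (rule dyadic_step_prod)
  fix k assume "n < 2 ^ N" "k \<in> {k. bit n k}"
  then have "k < N"
    by (metis (mono_tags) bit_take_bit_iff mem_Collect_eq take_bit_nat_eq_self)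
  then show "dyadic_step N (rademacher k)" by (rule rademacher_step)
qed

lemma walsh_0 [simp]: "walsh 0 x = 1"
  by (simp add: walsh_def)

lemma walsh_add_pow2:
  assumes "k < 2 ^ a"
  shows "walsh (2 ^ a + k) x = rademacher a x * walsh k x"
proof -
  have na: "\<not> bit k a" using assms
    by (metis bit_take_bit_iff less_irrefl take_bit_nat_eq_self)
  have "bit (2 ^ a + k) j \<longleftrightarrow> j = a \<or> bit k j" for j
  proof -
    have "2 ^ a + k = set_bit a k"
      using na by (simp add: set_bit_eq)
    then show ?thesis by (auto simp: bit_set_bit_iff)
  qed
  then have "{j. bit (2 ^ a + k) j} = insert a {j. bit k j}" by auto
  then show ?thesis using na by (simp add: walsh_def finite_bits)
qed

text \<open>The Dirichlet kernel in two variables; it is the usual kernel \<open>D\<^sub>n\<close> at the dyadic sum of \<open>x\<close>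
  and \<open>t\<close>.\<close>

definition dirichlet :: "nat \<Rightarrow> real \<Rightarrow> real \<Rightarrow> real" where
  "dirichlet n x t = (\<Sum>k<n. walsh k x * walsh k t)"

text \<open>The unnormalised Fejer kernel \<open>n K\<^sub>n\<close>.\<close>

definition fejer_sum :: "nat \<Rightarrow> real \<Rightarrow> real \<Rightarrow> real" where
  "fejer_sum n x t = (\<Sum>k=1..n. dirichlet k x t)"

abbreviation rad_mult :: "nat \<Rightarrow> real \<Rightarrow> real \<Rightarrow> real" where
  "rad_mult a x t \<equiv> rademacher a x * rademacher a t"

lemma rad_mult_cases: "rad_mult a x t = 1 \<or> rad_mult a x t = - 1"
  using rademacher_cases[of a x] rademacher_cases[of a t] by auto

lemma dirichlet_commute: "dirichlet n x t = dirichlet n t x"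
  by (simp add: dirichlet_def mult.commute)

lemma fejer_sum_commute: "fejer_sum n x t = fejer_sum n t x"
  by (simp add: fejer_sum_def dirichlet_commute)

lemma dirichlet_step: "n \<le> 2 ^ N \<Longrightarrow> dyadic_step N (dirichlet n x)"
  unfolding dirichlet_def[abs_def]
  by (intro dyadic_step_sum dyadic_step_comp[of _ _ "\<lambda>y. _ * y"] walsh_step) auto

lemma fejer_sum_step: "n \<le> 2 ^ N \<Longrightarrow> dyadic_step N (fejer_sum n x)"
  unfolding fejer_sum_def[abs_def] by (intro dyadic_step_sum dirichlet_step) auto

lemma sum_lessThan_add: "(\<Sum>i<m + k. F i) = (\<Sum>i<m. F i) + (\<Sum>i<k. F (m + i))"
  for F :: "nat \<Rightarrow> real"
  by (induction k) auto

lemma sum_1_add: "(\<Sum>i=1..m + k. F i) = (\<Sum>i=1..m. F i) + (\<Sum>i=1..k. F (m + i))"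
  for F :: "nat \<Rightarrow> real"
  by (induction k) auto

lemma dirichlet_add:
  assumes "k \<le> 2 ^ a"
  shows "dirichlet (2 ^ a + k) x t = dirichlet (2 ^ a) x t + rad_mult a x t * dirichlet k x t"
  unfolding dirichlet_def sum_lessThan_add sum_distrib_left using assms
  by (intro arg_cong2[of _ _ _ _ "(+)"] sum.cong) (auto simp: walsh_add_pow2)

lemma fejer_sum_add:
  assumes "k \<le> 2 ^ a"
  shows "fejer_sum (2 ^ a + k) x t
    = fejer_sum (2 ^ a) x t + real k * dirichlet (2 ^ a) x t + rad_mult a x t * fejer_sum k x t"
proof -
  have "(\<Sum>i=1..k. dirichlet (2 ^ a + i) x t) = (\<Sum>i=1..k. dirichlet (2 ^ a) x t + rad_mult a x t * dirichlet i x t)"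
    using assms by (intro sum.cong refl dirichlet_add) auto
  then show ?thesis
    unfolding fejer_sum_def sum_1_add by (simp add: sum.distrib sum_distrib_left)
qed

lemma dirichlet_1 [simp]: "dirichlet (Suc 0) x t = 1"
  by (simp add: dirichlet_def)

lemma fejer_sum_0 [simp]: "fejer_sum 0 x t = 0" and fejer_sum_1 [simp]: "fejer_sum (Suc 0) x t = 1"
  by (simp_all add: fejer_sum_def)

lemma dirichlet_pow2_Suc: "dirichlet (2 ^ Suc a) x t = (1 + rad_mult a x t) * dirichlet (2 ^ a) x t"
  using dirichlet_add[of "2 ^ a" a x t] by (simp add: mult_2 algebra_simps)

lemma fejer_sum_pow2_Suc:
  "fejer_sum (2 ^ Suc a) x t = (1 + rad_mult a x t) * fejer_sum (2 ^ a) x t + 2 ^ a * dirichlet (2 ^ a) x t"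
  using fejer_sum_add[of "2 ^ a" a x t] by (simp add: mult_2 algebra_simps)

lemma rad_mult_nonneg: "0 \<le> 1 + rad_mult a x t"
  using rad_mult_cases[of a x t] by auto

lemma dirichlet_pow2_nonneg: "0 \<le> dirichlet (2 ^ a) x t"
  by (induction a) (auto simp: dirichlet_pow2_Suc rad_mult_nonneg simp del: power_Suc)

lemma fejer_sum_pow2_nonneg: "0 \<le> fejer_sum (2 ^ a) x t"
  by (induction a) (auto simp: fejer_sum_pow2_Suc rad_mult_nonneg dirichlet_pow2_nonneg simp del: power_Suc)

text \<open>The function \<open>Q\<^sub>a + 2\<^sup>a D\<^bsub>2^a\<^esub>\<close>; summed over \<open>a < L\<close> it dominates \<open>n |K\<^sub>n|\<close> for \<open>n < 2\<^sup>L\<close>.\<close>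

definition fejer_majorant :: "nat \<Rightarrow> real \<Rightarrow> real \<Rightarrow> real" where
  "fejer_majorant a x t = fejer_sum (2 ^ a) x t + 2 ^ a * dirichlet (2 ^ a) x t"

lemma fejer_majorant_nonneg: "0 \<le> fejer_majorant a x t"
  by (simp add: fejer_majorant_def fejer_sum_pow2_nonneg dirichlet_pow2_nonneg)

lemma fejer_majorant_step: "a \<le> N \<Longrightarrow> dyadic_step N (fejer_majorant a x)"
  unfolding fejer_majorant_def[abs_def]
  by (rule dyadic_step_comp2[of _ _ _ "\<lambda>u v. u + 2 ^ a * v"]) (auto intro!: dirichlet_step fejer_sum_step)

lemma fejer_majorant_commute: "fejer_majorant a x t = fejer_majorant a t x"
  by (simp add: fejer_majorant_def fejer_sum_commute[of _ x] dirichlet_commute[of _ x])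

lemma fejer_sum_bound: "n < 2 ^ L \<Longrightarrow> \<bar>fejer_sum n x t\<bar> \<le> (\<Sum>a<L. fejer_majorant a x t)"
proof (induction L arbitrary: n)
  case (Suc L)
  show ?case
  proof (cases "n < 2 ^ L")
    case True
    then show ?thesis using Suc.IH[OF True] fejer_majorant_nonneg[of L x t] by simp
  next
    case False
    define k where "k = n - 2 ^ L"
    have n: "n = 2 ^ L + k" and k: "k < 2 ^ L" using False Suc.prems by (auto simp: k_def)
    have kr: "real k \<le> 2 ^ L" using k by (metis less_imp_le of_nat_le_iff of_nat_numeral of_nat_power)
    have "\<bar>rad_mult L x t\<bar> = 1" using rad_mult_cases[of L x t] by (metis abs_1 abs_minus_cancel)
    then have "\<bar>rad_mult L x t * fejer_sum k x t\<bar> = \<bar>fejer_sum k x t\<bar>"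
      unfolding abs_mult[of "rad_mult L x t"] by simp
    moreover have "real k * dirichlet (2 ^ L) x t \<le> 2 ^ L * dirichlet (2 ^ L) x t"
      using kr dirichlet_pow2_nonneg by (rule mult_right_mono)
    moreover have "0 \<le> real k * dirichlet (2 ^ L) x t" using dirichlet_pow2_nonneg by simp
    ultimately have "\<bar>fejer_sum n x t\<bar> \<le> fejer_majorant L x t + \<bar>fejer_sum k x t\<bar>"
      using fejer_sum_pow2_nonneg[of L x t] unfolding n fejer_sum_add[OF less_imp_le[OF k]] fejer_majorant_def
      by linarith
    then show ?thesis using Suc.IH[OF k] by simp
  qed
qed simp

text \<open>For fixed \<open>x\<close>, the sign \<open>R\<^sub>a(x,t)\<close> takes both values with probability 1/2 independently of the first
  \<open>a\<close> binary digits of \<open>t\<close>.\<close>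

lemma grid_mean_Suc_rad_mult:
  assumes "dyadic_step a \<phi>"
  shows "grid_mean (Suc a) (\<lambda>t. \<Psi> (\<phi> t) (rad_mult a x t)) = grid_mean a (\<lambda>t. (\<Psi> (\<phi> t) 1 + \<Psi> (\<phi> t) (- 1)) / 2)"
  unfolding grid_mean_Suc
proof (rule grid_mean_cong)
  fix t assume t: "t \<in> grid a"
  have "\<phi> (t + 1 / 2 ^ Suc a) = \<phi> t"
    using dyadic_stepD[OF assms grid_half(1)[OF t] grid_unit[OF t]] grid_half(2)[OF t] by blast
  then show "(\<Psi> (\<phi> t) (rad_mult a x t) + \<Psi> (\<phi> (t + 1 / 2 ^ Suc a)) (rad_mult a x (t + 1 / 2 ^ Suc a))) / 2
      = (\<Psi> (\<phi> t) 1 + \<Psi> (\<phi> t) (- 1)) / 2"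
    using rademacher_cases[of a x] unfolding rademacher_grid[OF t] by auto
qed

lemma grid_mean_Suc_rad_mult_mult:
  "dyadic_step a \<phi> \<Longrightarrow> grid_mean (Suc a) (\<lambda>t. (1 + rad_mult a x t) * \<phi> t) = grid_mean a \<phi>"
  using grid_mean_Suc_rad_mult[of a \<phi> "\<lambda>u r. (1 + r) * u" x] by simp

lemma grid_mean_dirichlet_pow2: "a \<le> N \<Longrightarrow> grid_mean N (dirichlet (2 ^ a) x) = 1"
proof -
  have "grid_mean a (dirichlet (2 ^ a) x) = 1"
    by (induction a) (simp_all add: dirichlet_pow2_Suc grid_mean_Suc_rad_mult_mult dirichlet_step del: power_Suc)
  then show "a \<le> N \<Longrightarrow> ?thesis" using grid_mean_step[OF dirichlet_step[OF order_refl, of a x], of N] by simp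
qed

lemma grid_mean_fejer_sum_pow2: "a \<le> N \<Longrightarrow> grid_mean N (fejer_sum (2 ^ a) x) = 2 ^ a"
proof -
  have "grid_mean a (fejer_sum (2 ^ a) x) = 2 ^ a"
  proof (induction a)
    case (Suc a)
    have "grid_mean (Suc a) (dirichlet (2 ^ a) x) = 1" by (rule grid_mean_dirichlet_pow2) simp
    then show ?case using Suc
      by (simp add: fejer_sum_pow2_Suc grid_mean_Suc_rad_mult_mult fejer_sum_step grid_mean_add grid_mean_cmult del: power_Suc)
        simp
  qed simp
  then show "a \<le> N \<Longrightarrow> ?thesis" using grid_mean_step[OF fejer_sum_step[OF order_refl, of a x], of N] by simp
qed

lemma grid_mean_fejer_majorant: "a \<le> N \<Longrightarrow> grid_mean N (fejer_majorant a x) = 2 * 2 ^ a"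
  by (simp add: fejer_majorant_def[abs_def] grid_mean_add grid_mean_cmult grid_mean_dirichlet_pow2 grid_mean_fejer_sum_pow2)

lemma sum_pow2: "(\<Sum>a<n. 2 ^ a) = (2 ^ n - 1 :: real)"
  by (induction n) auto

lemma pow2_bracket:
  assumes "1 \<le> (n::nat)"
  obtains L where "2 ^ L \<le> n" "n < 2 ^ Suc L"
  using ex_power_ivl1[of 2 n] assms by auto

text \<open>The Fejer operators are uniformly bounded on \<open>L\<^sup>\<infinity>\<close>, with constant 4.\<close>

lemma fejer_bounded:
  assumes g: "\<And>t. t \<in> grid N \<Longrightarrow> \<bar>g t\<bar> \<le> A" and n: "n \<le> 2 ^ N" and A: "0 \<le> A"
  shows "\<bar>grid_mean N (\<lambda>t. g t * fejer_sum n x t)\<bar> \<le> 4 * A * real n"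
proof (cases "n = 0")
  case False
  then have "1 \<le> n" by simp
  then obtain L where L: "2 ^ L \<le> n" "n < 2 ^ Suc L" by (rule pow2_bracket)
  have LN: "L \<le> N" using L(1) n by (meson le_trans one_less_numeral_iff power_increasing_iff semiring_norm(76))
  have Lr: "2 ^ L \<le> real n" using L(1) by (metis of_nat_le_iff of_nat_numeral of_nat_power)
  have "\<bar>grid_mean N (\<lambda>t. g t * fejer_sum n x t)\<bar> \<le> grid_mean N (\<lambda>t. \<bar>g t * fejer_sum n x t\<bar>)" by (rule grid_mean_abs)
  also have "\<dots> \<le> grid_mean N (\<lambda>t. A * (\<Sum>a<Suc L. fejer_majorant a x t))"
    by (rule grid_mean_mono) (use fejer_sum_bound[OF L(2)] g A in \<open>auto simp: abs_mult intro!: mult_mono\<close>)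
  also have "\<dots> = A * (\<Sum>a<Suc L. grid_mean N (fejer_majorant a x))" by (simp only: grid_mean_cmult grid_mean_sum)
  also have "\<dots> = A * (\<Sum>a<Suc L. 2 * 2 ^ a)" using LN by (intro arg_cong[of _ _ "(*) A"] sum.cong) (auto simp: grid_mean_fejer_majorant)
  also have "(\<Sum>a<Suc L. 2 * 2 ^ a) = 2 * (2 ^ Suc L - 1 :: real)"
    unfolding sum_distrib_left[symmetric] sum_pow2 ..
  also have "A * \<dots> \<le> A * (4 * real n)"
  proof (rule mult_left_mono[OF _ A])
    have "2 * (2 * z - 1) \<le> 4 * y" if "z \<le> y" for y z :: real using that by simp
    from this[OF Lr] show "2 * (2 ^ Suc L - 1) \<le> 4 * real n" by (simp only: power_Suc)
  qed
  finally show ?thesis by simp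
qed (simp add: A)

section \<open>Fejer means of atoms\<close>

lemma dirichlet_pow2_zero:
  assumes "x \<in> {0..<1}" "t \<in> {0..<1}" "\<lfloor>2 ^ a * x\<rfloor> \<noteq> \<lfloor>2 ^ a * t\<rfloor>"
  shows "dirichlet (2 ^ a) x t = 0"
  using assms(3)
proof (induction a)
  case 0
  have "\<lfloor>x\<rfloor> = 0" "\<lfloor>t\<rfloor> = 0" using assms by (auto simp: floor_eq_iff)
  then show ?case using 0 by simp
next
  case (Suc a)
  show ?case
  proof (cases "\<lfloor>2 ^ a * x\<rfloor> = \<lfloor>2 ^ a * t\<rfloor>")
    case True
    then have "\<lfloor>2 ^ Suc a * x\<rfloor> div 2 = \<lfloor>2 ^ Suc a * t\<rfloor> div 2" 
      using floor_pow2_Suc[of a x] floor_pow2_Suc[of a t] by argo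
    moreover have "even u \<noteq> even w" if "u div 2 = w div 2" "u \<noteq> w" for u w :: int
      using that by presburger
    ultimately have "even \<lfloor>2 ^ Suc a * x\<rfloor> \<noteq> even \<lfloor>2 ^ Suc a * t\<rfloor>" using Suc.prems by blast
    then have "rad_mult a x t = - 1" unfolding rademacher_parity by (simp split: if_splits)
    then show ?thesis unfolding dirichlet_pow2_Suc by simp
  next
    case False
    then show ?thesis unfolding dirichlet_pow2_Suc using Suc.IH by simp
  qed
qed

text \<open>The indicator function of the level-\<open>m\<close> dyadic interval that contains \<open>c\<close>.\<close>

abbreviation cell_ind :: "nat \<Rightarrow> real \<Rightarrow> real \<Rightarrow> real" where
  "cell_ind m c t \<equiv> of_bool (\<lfloor>2 ^ m * t\<rfloor> = \<lfloor>2 ^ m * c\<rfloor>)"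

lemma cell_ind_step: "m \<le> N \<Longrightarrow> dyadic_step N (cell_ind m c)"
  by (rule dyadic_step_mono[OF dyadic_step_comp[OF dyadic_step_cell]])

lemma grid_mean_cell_mult:
  assumes "dyadic_step m g" "c \<in> grid m" "m \<le> N"
  shows "grid_mean N (\<lambda>t. cell_ind m c t * g t) = g c / 2 ^ m"
proof -
  have "grid_mean N (\<lambda>t. cell_ind m c t * g t) = grid_mean N (\<lambda>t. g c * cell_ind m c t)"
    by (rule grid_mean_cong) (use dyadic_stepD[OF assms(1) _ grid_unit[OF assms(2)]] grid_unit in auto)
  then show ?thesis by (simp add: grid_mean_cmult grid_mean_cell[OF assms(2,3)])
qed

text \<open>From level \<open>m\<close> on, the integral of the majorant over an interval of level \<open>m\<close> that does not contain
  \<open>x\<close> no longer depends on \<open>a\<close>: the Dirichlet kernels vanish there, and the factor \<open>1 + R\<^sub>a\<close> has mean 1.\<close>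

lemma grid_mean_cell_fejer_sum:
  assumes c: "c \<in> grid m" and x: "x \<in> {0..<1}" "\<lfloor>2 ^ m * x\<rfloor> \<noteq> \<lfloor>2 ^ m * c\<rfloor>"
    and a: "m \<le> a" "a \<le> N"
  shows "grid_mean N (\<lambda>t. cell_ind m c t * fejer_majorant a x t) = fejer_sum (2 ^ m) x c / 2 ^ m"
proof -
  have D: "cell_ind m c t * dirichlet (2 ^ k) x t = 0" if "m \<le> k" "t \<in> {0..<1}" for k t
  proof (cases "\<lfloor>2 ^ m * t\<rfloor> = \<lfloor>2 ^ m * c\<rfloor>")
    case True
    then have "\<lfloor>2 ^ k * x\<rfloor> \<noteq> \<lfloor>2 ^ k * t\<rfloor>" using same_cell_mono[OF _ that(1), of x t] x(2) by metis
    then show ?thesis using dirichlet_pow2_zero[OF x(1) that(2)] by simp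
  qed simp
  have "grid_mean a (\<lambda>t. cell_ind m c t * fejer_sum (2 ^ a) x t) = fejer_sum (2 ^ m) x c / 2 ^ m"
    using a(1)
  proof (induction rule: dec_induct)
    case base
    show ?case by (rule grid_mean_cell_mult[OF fejer_sum_step c]) auto
  next
    case (step k)
    have "grid_mean (Suc k) (\<lambda>t. cell_ind m c t * fejer_sum (2 ^ Suc k) x t)
      = grid_mean (Suc k) (\<lambda>t. (1 + rad_mult k x t) * (cell_ind m c t * fejer_sum (2 ^ k) x t))"
    proof (rule grid_mean_cong)
      fix t assume "t \<in> grid (Suc k)"
      from D[OF step(1) grid_unit[OF this]]
      show "cell_ind m c t * fejer_sum (2 ^ Suc k) x t = (1 + rad_mult k x t) * (cell_ind m c t * fejer_sum (2 ^ k) x t)"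
        unfolding fejer_sum_pow2_Suc by (auto simp: algebra_simps)
    qed
    also have "\<dots> = grid_mean k (\<lambda>t. cell_ind m c t * fejer_sum (2 ^ k) x t)"
      by (rule grid_mean_Suc_rad_mult_mult)
        (rule dyadic_step_comp2[OF cell_ind_step[OF step(1)] fejer_sum_step[OF order_refl]])
    finally show ?case using step by simp
  qed
  moreover have "grid_mean N (\<lambda>t. cell_ind m c t * fejer_sum (2 ^ a) x t) = grid_mean a (\<lambda>t. cell_ind m c t * fejer_sum (2 ^ a) x t)"
    by (rule grid_mean_step[OF dyadic_step_comp2[OF cell_ind_step[OF a(1)] fejer_sum_step[OF order_refl]] a(2)])
  moreover have "grid_mean N (\<lambda>t. cell_ind m c t * fejer_majorant a x t) = grid_mean N (\<lambda>t. cell_ind m c t * fejer_sum (2 ^ a) x t)"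
    by (rule grid_mean_cong) (use D[OF a(1) grid_unit] in \<open>auto simp: fejer_majorant_def\<close>)
  ultimately show ?thesis by simp
qed

text \<open>The function that dominates, outside the level-\<open>m\<close> interval at \<open>c\<close>, all Fejer means of atoms of
  height 1 supported in that interval.\<close>

definition atom_bound :: "nat \<Rightarrow> real \<Rightarrow> real \<Rightarrow> real" where
  "atom_bound m x c = (\<Sum>a\<le>m. fejer_majorant a x c) / 4 ^ m"

lemma atom_bound_nonneg: "0 \<le> atom_bound m x c"
  by (simp add: atom_bound_def sum_nonneg fejer_majorant_nonneg)

lemma fejer_atom:
  assumes c: "c \<in> grid m" and mN: "m \<le> N"
    and supp: "\<And>t. t \<in> grid N \<Longrightarrow> \<lfloor>2 ^ m * t\<rfloor> \<noteq> \<lfloor>2 ^ m * c\<rfloor> \<Longrightarrow> g t = 0"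
    and mean: "grid_mean N g = 0"
    and A: "\<And>t. t \<in> grid N \<Longrightarrow> \<bar>g t\<bar> \<le> A"
    and x: "x \<in> {0..<1}" "\<lfloor>2 ^ m * x\<rfloor> \<noteq> \<lfloor>2 ^ m * c\<rfloor>"
    and n: "n \<le> 2 ^ N"
  shows "\<bar>grid_mean N (\<lambda>t. g t * fejer_sum n x t)\<bar> \<le> real n * (A * atom_bound m x c)"
proof -
  have "(0::real) \<in> grid N" by (force simp: grid_def)
  then have A0: "0 \<le> A" using A[of 0] by simp
  show ?thesis
  proof (cases "n < 2 ^ m")
    case True
    \<comment> \<open>For small \<open>n\<close> the kernel is constant on the support, so the mean vanishes.\<close>
    have "grid_mean N (\<lambda>t. g t * fejer_sum n x t) = grid_mean N (\<lambda>t. fejer_sum n x c * g t)"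
    proof (rule grid_mean_cong)
      fix t assume t: "t \<in> grid N"
      show "g t * fejer_sum n x t = fejer_sum n x c * g t"
        using supp[OF t] dyadic_stepD[OF fejer_sum_step[OF less_imp_le[OF True]] grid_unit[OF t] grid_unit[OF c]]
        by (cases "g t = 0") auto
    qed
    then show ?thesis by (simp add: grid_mean_cmult mean A0 atom_bound_nonneg)
  next
    case False
    have "(1::nat) \<le> 2 ^ m" by simp
    then have "1 \<le> n" using False by linarith
    then obtain L where L: "2 ^ L \<le> n" "n < 2 ^ Suc L" by (rule pow2_bracket)
    have LN: "L \<le> N" using L(1) n by (meson le_trans one_less_numeral_iff power_increasing_iff semiring_norm(76))
    have "(2::nat) ^ m < 2 ^ Suc L" using False L(2) by linarith
    then have "m < Suc L" by (rule power_less_imp_less_exp[rotated]) simp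
    then have mL: "m \<le> L" by simp
    define S where "S = (\<Sum>a\<le>m. fejer_majorant a x c)"
    have qS: "fejer_sum (2 ^ m) x c \<le> S"
    proof -
      have "fejer_sum (2 ^ m) x c \<le> fejer_majorant m x c" by (simp add: fejer_majorant_def dirichlet_pow2_nonneg)
      also have "\<dots> \<le> S" unfolding S_def by (rule member_le_sum) (auto simp: fejer_majorant_nonneg)
      finally show ?thesis .
    qed
    have S0: "0 \<le> S" by (simp add: S_def sum_nonneg fejer_majorant_nonneg)
    have "\<bar>grid_mean N (\<lambda>t. g t * fejer_sum n x t)\<bar> \<le> grid_mean N (\<lambda>t. \<bar>g t * fejer_sum n x t\<bar>)" by (rule grid_mean_abs)
    also have "\<dots> \<le> grid_mean N (\<lambda>t. A * (\<Sum>a<Suc L. cell_ind m c t * fejer_majorant a x t))"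
    proof (rule grid_mean_mono)
      fix t assume t: "t \<in> grid N"
      show "\<bar>g t * fejer_sum n x t\<bar> \<le> A * (\<Sum>a<Suc L. cell_ind m c t * fejer_majorant a x t)"
      proof (cases "\<lfloor>2 ^ m * t\<rfloor> = \<lfloor>2 ^ m * c\<rfloor>")
        case True
        have "\<bar>g t\<bar> * \<bar>fejer_sum n x t\<bar> \<le> A * (\<Sum>a<Suc L. fejer_majorant a x t)"
          by (rule mult_mono[OF A[OF t] fejer_sum_bound[OF L(2)] A0 abs_ge_zero])
        then show ?thesis using True by (simp only: abs_mult of_bool_def if_True mult_1 simp_thms)
      next
        case False
        then show ?thesis using supp[OF t] by simp
      qed
    qed
    also have "\<dots> = A * (\<Sum>a<Suc L. grid_mean N (\<lambda>t. cell_ind m c t * fejer_majorant a x t))"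
      by (simp only: grid_mean_cmult grid_mean_sum)
    also have "{..<Suc L} = {..m} \<union> {m<..L}" using mL by auto
    also have "(\<Sum>a\<in>{..m} \<union> {m<..L}. grid_mean N (\<lambda>t. cell_ind m c t * fejer_majorant a x t))
        = (\<Sum>a\<le>m. grid_mean N (\<lambda>t. cell_ind m c t * fejer_majorant a x t)) + (\<Sum>a\<in>{m<..L}. grid_mean N (\<lambda>t. cell_ind m c t * fejer_majorant a x t))"
      by (rule sum.union_disjoint) auto
    also have "(\<Sum>a\<le>m. grid_mean N (\<lambda>t. cell_ind m c t * fejer_majorant a x t)) = (\<Sum>a\<le>m. fejer_majorant a x c / 2 ^ m)"
      by (intro sum.cong refl grid_mean_cell_mult[OF _ c mN] fejer_majorant_step) simp
    also have "(\<Sum>a\<in>{m<..L}. grid_mean N (\<lambda>t. cell_ind m c t * fejer_majorant a x t)) = (\<Sum>a\<in>{m<..L}. fejer_sum (2 ^ m) x c / 2 ^ m)"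
      using LN by (intro sum.cong refl grid_mean_cell_fejer_sum[OF c x]) auto
    also have "(\<Sum>a\<le>m. fejer_majorant a x c / 2 ^ m) + (\<Sum>a\<in>{m<..L}. fejer_sum (2 ^ m) x c / 2 ^ m)
        \<le> real n * (S / 4 ^ m)"
    proof -
      \<comment> \<open>The \<open>L - m\<close> levels beyond \<open>m\<close> contribute equally; dividing by \<open>n \<ge> 2\<^sup>L\<close> absorbs their number.\<close>
      have "(1 + real (L - m)) * 2 ^ m \<le> real n"
      proof -
        have "1 + (L - m) \<le> 2 ^ (L - m)" using less_exp[of "L - m"] by linarith
        then have "(1 + (L - m)) * 2 ^ m \<le> 2 ^ (L - m) * 2 ^ m" by (rule mult_right_mono) simp
        also have "\<dots> = 2 ^ L" using mL by (simp flip: power_add)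
        finally have "(1 + (L - m)) * 2 ^ m \<le> n" using L(1) by linarith
        then have "real ((1 + (L - m)) * 2 ^ m) \<le> real n" by (simp only: of_nat_le_iff)
        then show ?thesis by (simp add: distrib_right)
      qed
      then have "1 + real (L - m) \<le> real n / 2 ^ m" by (simp add: field_simps)
      then have *: "(1 + real (L - m)) * S / 2 ^ m \<le> real n / 2 ^ m * S / 2 ^ m"
        using S0 by (intro divide_right_mono mult_right_mono) auto
      have "(\<Sum>a\<le>m. fejer_majorant a x c / 2 ^ m) + (\<Sum>a\<in>{m<..L}. fejer_sum (2 ^ m) x c / 2 ^ m)
          = S / 2 ^ m + real (L - m) * fejer_sum (2 ^ m) x c / 2 ^ m"
        by (simp add: S_def sum_divide_distrib)
      also have "\<dots> \<le> S / 2 ^ m + real (L - m) * S / 2 ^ m"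
        using qS by (intro add_left_mono divide_right_mono mult_left_mono) auto
      also have "\<dots> = (1 + real (L - m)) * S / 2 ^ m" by (simp add: field_simps)
      also note *
      also have "real n / 2 ^ m * S / 2 ^ m = real n * (S / 4 ^ m)"
        by (simp add: field_simps flip: power_mult_distrib)
      finally show ?thesis .
    qed
    then have "A * ((\<Sum>a\<le>m. fejer_majorant a x c / 2 ^ m) + (\<Sum>a\<in>{m<..L}. fejer_sum (2 ^ m) x c / 2 ^ m))
        \<le> A * (real n * (S / 4 ^ m))" using A0 by (rule mult_left_mono)
    finally show ?thesis by (simp add: atom_bound_def S_def algebra_simps)
  qed
qed

lemma powr_subadd:
  fixes x y q :: real
  assumes "0 \<le> x" "0 \<le> y" "0 < q" "q \<le> 1"
  shows "(x + y) powr q \<le> x powr q + y powr q"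
proof (cases "x + y = 0")
  case False
  then have s: "0 < x + y" using assms by simp
  have *: "u / (x + y) \<le> (u / (x + y)) powr q" if "0 \<le> u" "u \<le> x + y" for u
    using powr_mono'[of q 1 "u / (x + y)"] that s assms by simp
  have "1 = x / (x + y) + y / (x + y)" using s by (simp flip: add_divide_distrib)
  also have "\<dots> \<le> (x / (x + y)) powr q + (y / (x + y)) powr q"
    using assms by (intro add_mono *) auto
  also have "\<dots> = (x powr q + y powr q) / (x + y) powr q"
    using assms s by (simp add: powr_divide add_divide_distrib)
  finally show ?thesis using s by (simp add: field_simps)
qed (use assms in auto)

lemma powr_sum_subadd:
  fixes q :: real
  assumes "0 < q" "q \<le> 1" "finite I" "\<And>i. i \<in> I \<Longrightarrow> 0 \<le> u i"
  shows "(\<Sum>i\<in>I. u i) powr q \<le> (\<Sum>i\<in>I. u i powr q)"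
  using assms(3,4)
proof (induction rule: finite_induct)
  case (insert i I)
  have nn: "0 \<le> u i" "\<And>j. j \<in> I \<Longrightarrow> 0 \<le> u j" using insert.prems by blast+
  have "(u i + (\<Sum>i\<in>I. u i)) powr q \<le> u i powr q + (\<Sum>i\<in>I. u i) powr q"
    using nn assms(1,2) by (intro powr_subadd sum_nonneg) blast+
  also have "\<dots> \<le> u i powr q + (\<Sum>i\<in>I. u i powr q)"
    using insert.IH[OF nn(2)] by simp
  finally show ?case using insert.hyps by simp
qed simp

lemma grid_mean_Suc_rad_mult_powr:
  assumes "dyadic_step a \<phi>" "\<And>t. 0 \<le> \<phi> t" "0 < q"
  shows "grid_mean (Suc a) (\<lambda>t. ((1 + rad_mult a x t) * \<phi> t) powr q) = 2 powr (q - 1) * grid_mean a (\<lambda>t. \<phi> t powr q)"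
proof -
  have "grid_mean (Suc a) (\<lambda>t. ((1 + rad_mult a x t) * \<phi> t) powr q) = grid_mean a (\<lambda>t. 2 powr (q - 1) * \<phi> t powr q)"
    using grid_mean_Suc_rad_mult[OF assms(1), of "\<lambda>u r. ((1 + r) * u) powr q" x] assms(2,3)
    by (simp add: powr_mult powr_diff)
  then show ?thesis by (simp add: grid_mean_cmult)
qed

lemma grid_mean_dirichlet_powr:
  assumes "0 < q"
  shows "grid_mean a (\<lambda>t. dirichlet (2 ^ a) x t powr q) = (2 powr (q - 1)) ^ a"
proof (induction a)
  case (Suc a)
  then show ?case unfolding dirichlet_pow2_Suc
    by (subst grid_mean_Suc_rad_mult_powr) (auto simp: assms dirichlet_step dirichlet_pow2_nonneg)
qed simp

lemma powr_pow2: "(2 ^ a * u) powr q = (2 powr q) ^ a * u powr q" if "0 \<le> u" for u q :: real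
  using that by (simp add: powr_mult powr_power powr_realpow[symmetric] powr_powr mult.commute)

text \<open>With \<open>\<alpha> = 2\<^bsup>q-1\<^esup>\<close> and \<open>\<beta> = 2\<^bsup>2q-1\<^esup>\<close>, the \<open>q\<close>-th moments \<open>u\<^sub>a\<close> of \<open>Q\<^sub>a\<close> satisfy
  \<open>u\<^bsub>a+1\<^esub> \<le> \<alpha> u\<^sub>a + \<beta>\<^sup>a\<close>, and \<open>C \<beta>\<^sup>a\<close> is a supersolution as soon as \<open>C (\<beta> - \<alpha>) \<ge> 1\<close>.\<close>

lemma grid_mean_fejer_sum_powr:
  assumes q: "0 < q" "q \<le> 1"
  shows "grid_mean a (\<lambda>t. fejer_sum (2 ^ a) x t powr q)
    \<le> (1 + 1 / (2 powr (2 * q - 1) - 2 powr (q - 1))) * (2 powr (2 * q - 1)) ^ a"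
proof -
  define \<alpha> \<beta> C :: real where "\<alpha> = 2 powr (q - 1)" and "\<beta> = 2 powr (2 * q - 1)" and "C = 1 + 1 / (\<beta> - \<alpha>)"
  have ab: "\<alpha> < \<beta>" "0 < \<alpha>" using q by (auto simp: \<alpha>_def \<beta>_def)
  have ab2: "2 powr q * \<alpha> = \<beta>" by (simp add: \<alpha>_def \<beta>_def flip: powr_add)
  have C1: "\<alpha> * C + 1 \<le> \<beta> * C" 
  proof -
    have "(\<beta> - \<alpha>) * C = (\<beta> - \<alpha>) + 1" using ab by (simp add: C_def distrib_left)
    then show ?thesis using ab by (simp add: algebra_simps)
  qed
  have "grid_mean a (\<lambda>t. fejer_sum (2 ^ a) x t powr q) \<le> C * \<beta> ^ a"
  proof (induction a)
    case 0
    then show ?case using ab by (simp add: C_def)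
  next
    case (Suc a)
    have "grid_mean (Suc a) (\<lambda>t. fejer_sum (2 ^ Suc a) x t powr q)
      \<le> grid_mean (Suc a) (\<lambda>t. ((1 + rad_mult a x t) * fejer_sum (2 ^ a) x t) powr q
            + (2 powr q) ^ a * dirichlet (2 ^ a) x t powr q)"
      unfolding fejer_sum_pow2_Suc powr_pow2[OF dirichlet_pow2_nonneg, symmetric]
      by (rule grid_mean_mono, rule powr_subadd)
        (auto simp: q rad_mult_nonneg fejer_sum_pow2_nonneg dirichlet_pow2_nonneg)
    also have "\<dots> = \<alpha> * grid_mean a (\<lambda>t. fejer_sum (2 ^ a) x t powr q)
        + (2 powr q) ^ a * grid_mean (Suc a) (\<lambda>t. dirichlet (2 ^ a) x t powr q)"
      by (simp add: grid_mean_add grid_mean_cmult grid_mean_Suc_rad_mult_powr fejer_sum_step fejer_sum_pow2_nonneg q \<alpha>_def)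
    also have "grid_mean (Suc a) (\<lambda>t. dirichlet (2 ^ a) x t powr q) = grid_mean a (\<lambda>t. dirichlet (2 ^ a) x t powr q)"
      by (rule grid_mean_step[OF dyadic_step_comp[OF dirichlet_step[OF order_refl]]]) simp
    also have "\<dots> = \<alpha> ^ a" by (simp add: grid_mean_dirichlet_powr[OF q(1)] \<alpha>_def)
    also have "\<alpha> * grid_mean a (\<lambda>t. fejer_sum (2 ^ a) x t powr q) + (2 powr q) ^ a * \<alpha> ^ a \<le> \<alpha> * (C * \<beta> ^ a) + \<beta> ^ a"
      using Suc ab(2) by (intro add_mono mult_left_mono) (auto simp: ab2 simp flip: power_mult_distrib)
    also have "\<dots> = (\<alpha> * C + 1) * \<beta> ^ a" by (simp add: algebra_simps)
    also have "\<dots> \<le> \<beta> * C * \<beta> ^ a" using C1 ab by (intro mult_right_mono) auto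
    finally show ?case by (simp add: algebra_simps)
  qed
  then show ?thesis by (simp add: C_def \<alpha>_def \<beta>_def)
qed

text \<open>The constant in \<open>E G\<^sub>I\<^sup>q \<le> C\<^sub>q |I|\<close>. Its last factor sums the geometric series of ratio \<open>2\<^bsup>2q-1\<^esup>\<close>,
  which exceeds 1 precisely for \<open>q > 1/2\<close>.\<close>

definition atom_const :: "real \<Rightarrow> real" where
  "atom_const q = (2 + 1 / (2 powr (2 * q - 1) - 2 powr (q - 1))) * 2 powr (2 * q - 1) / (2 powr (2 * q - 1) - 1)"

lemma atom_const_nonneg: "1 / 2 < q \<Longrightarrow> 0 \<le> atom_const q"
  unfolding atom_const_def using ge_one_powr_ge_zero[of 2 "2 * q - 1"]
  by (intro divide_nonneg_nonneg mult_nonneg_nonneg add_nonneg_nonneg) auto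

lemma grid_mean_fejer_majorant_powr:
  assumes q: "0 < q" "q \<le> 1"
  shows "grid_mean a (\<lambda>t. fejer_majorant a x t powr q)
    \<le> (2 + 1 / (2 powr (2 * q - 1) - 2 powr (q - 1))) * (2 powr (2 * q - 1)) ^ a"
proof -
  have "grid_mean a (\<lambda>t. fejer_majorant a x t powr q)
      \<le> grid_mean a (\<lambda>t. fejer_sum (2 ^ a) x t powr q + (2 powr q) ^ a * dirichlet (2 ^ a) x t powr q)"
    unfolding fejer_majorant_def powr_pow2[OF dirichlet_pow2_nonneg, symmetric]
    by (rule grid_mean_mono, rule powr_subadd) (auto simp: q fejer_sum_pow2_nonneg dirichlet_pow2_nonneg)
  also have "\<dots> = grid_mean a (\<lambda>t. fejer_sum (2 ^ a) x t powr q) + (2 powr q * 2 powr (q - 1)) ^ a"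
    by (simp add: grid_mean_add grid_mean_cmult grid_mean_dirichlet_powr[OF q(1)] power_mult_distrib)
  also have "2 powr q * 2 powr (q - 1) = 2 powr (2 * q - 1)" by (simp flip: powr_add)
  finally show ?thesis using grid_mean_fejer_sum_powr[OF q, of a x] by (simp add: algebra_simps)
qed

lemma grid_mean_atom_bound:
  assumes q: "1 / 2 < q" "q \<le> 1" and m: "m \<le> N"
  shows "grid_mean N (\<lambda>x. atom_bound m x c powr q) \<le> atom_const q / 2 ^ m"
proof -
  define \<beta> C :: real where "\<beta> = 2 powr (2 * q - 1)" and "C = 2 + 1 / (\<beta> - 2 powr (q - 1))"
  have b: "1 < \<beta>" using q by (simp add: \<beta>_def)
  have C: "0 \<le> C" using q by (simp add: C_def \<beta>_def)
  have st: "dyadic_step N (\<lambda>x. fejer_majorant a x c)" if "a \<le> N" for a N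
    using fejer_majorant_step[OF that, of c] by (simp add: fejer_majorant_commute[of _ _ c])
  have "grid_mean N (\<lambda>x. atom_bound m x c powr q) \<le> grid_mean N (\<lambda>x. (\<Sum>a\<le>m. fejer_majorant a x c powr q) * (1 / 4 ^ m) powr q)"
  proof (rule grid_mean_mono)
    fix x
    have "atom_bound m x c powr q = (\<Sum>a\<le>m. fejer_majorant a x c) powr q * (1 / 4 ^ m) powr q"
      unfolding atom_bound_def by (subst powr_mult[symmetric]) (auto simp: sum_nonneg fejer_majorant_nonneg)
    also have "\<dots> \<le> (\<Sum>a\<le>m. fejer_majorant a x c powr q) * (1 / 4 ^ m) powr q"
      using q by (intro mult_right_mono powr_sum_subadd) (auto simp: fejer_majorant_nonneg)
    finally show "atom_bound m x c powr q \<le> (\<Sum>a\<le>m. fejer_majorant a x c powr q) * (1 / 4 ^ m) powr q" .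
  qed
  also have "\<dots> = (1 / 4 ^ m) powr q * (\<Sum>a\<le>m. grid_mean N (\<lambda>x. fejer_majorant a x c powr q))"
    by (simp only: grid_mean_cmult grid_mean_sum mult.commute[of _ "(1 / 4 ^ m) powr q"])
  also have "\<dots> \<le> (1 / 4 ^ m) powr q * (\<Sum>a\<le>m. C * \<beta> ^ a)"
  proof (intro mult_left_mono sum_mono)
    fix a assume "a \<in> {..m}"
    then have "grid_mean N (\<lambda>x. fejer_majorant a x c powr q) = grid_mean a (\<lambda>x. fejer_majorant a c x powr q)"
      using m by (subst grid_mean_step[OF dyadic_step_comp[OF st[OF order_refl]]]) (auto simp: fejer_majorant_commute[of _ _ c])
    then show "grid_mean N (\<lambda>x. fejer_majorant a x c powr q) \<le> C * \<beta> ^ a"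
      using grid_mean_fejer_majorant_powr[of q a c] q by (simp add: C_def \<beta>_def)
  qed simp
  also have "(\<Sum>a\<le>m. C * \<beta> ^ a) \<le> C * (\<beta> * \<beta> ^ m / (\<beta> - 1))"
  proof -
    have "(\<beta> - 1) * (\<Sum>a\<le>m. \<beta> ^ a) = \<beta> * \<beta> ^ m - 1"
      using power_diff_1_eq[of \<beta> "Suc m"] by (simp add: lessThan_Suc_atMost)
    then have "(\<Sum>a\<le>m. \<beta> ^ a) \<le> \<beta> * \<beta> ^ m / (\<beta> - 1)" using b by (simp add: pos_le_divide_eq mult.commute)
    then show ?thesis unfolding sum_distrib_left[symmetric] using C by (rule mult_left_mono)
  qed
  then have "(1 / 4 ^ m) powr q * (\<Sum>a\<le>m. C * \<beta> ^ a) \<le> (1 / 4 ^ m) powr q * (C * (\<beta> * \<beta> ^ m / (\<beta> - 1)))"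
    by (rule mult_left_mono) simp
  also have "\<dots> = C * \<beta> / (\<beta> - 1) * ((1 / 4 ^ m) powr q * \<beta> ^ m)" by simp
  also have "(1 / 4 ^ m) powr q * \<beta> ^ m = 1 / 2 ^ m"
  proof -
    have "(1 / 4 ^ m :: real) = 2 powr (- 2 * real m)"
      by (simp add: powr_minus powr_powr[symmetric] powr_realpow divide_inverse)
    then have "(1 / 4 ^ m) powr q * \<beta> ^ m = 2 powr (- 2 * real m * q + (2 * q - 1) * real m)"
      by (simp add: \<beta>_def powr_powr powr_power algebra_simps flip: powr_add)
    also have "- 2 * real m * q + (2 * q - 1) * real m = - real m" by (simp add: algebra_simps)
    finally show ?thesis by (simp add: powr_minus powr_realpow divide_inverse)
  qed
  finally show ?thesis by (simp add: atom_const_def C_def \<beta>_def)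
qed

section \<open>Stopping and the weak type inequality\<close>

text \<open>Since the increment \<open>h\<^bsub>j+1\<^esub> - h\<^sub>j\<close> has opposite signs on the two halves, the quantity
  \<open>|h\<^sub>j| + |h\<^bsub>j+1\<^esub> - h\<^sub>j|\<close> is the larger of the values of \<open>|h\<^bsub>j+1\<^esub>|\<close> on the two halves of the current
  interval. So \<open>alive h l i x\<close> says that up to time \<open>i + 1\<close> the martingale stays bounded by \<open>l\<close> at \<open>x\<close> and
  on the sibling intervals, and this is known at time \<open>i\<close>.\<close>

definition alive :: "(nat \<Rightarrow> real \<Rightarrow> real) \<Rightarrow> real \<Rightarrow> nat \<Rightarrow> real \<Rightarrow> bool" where
  "alive h l i x \<longleftrightarrow> (\<forall>j\<le>i. \<bar>h j x\<bar> + \<bar>h (Suc j) x - h j x\<bar> \<le> l)"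

text \<open>The martingale \<open>h\<close> stopped at the last moment before it can exceed \<open>l\<close> (for \<open>h\<^sub>0 = 0\<close>).\<close>

definition stopped :: "(nat \<Rightarrow> real \<Rightarrow> real) \<Rightarrow> real \<Rightarrow> nat \<Rightarrow> real \<Rightarrow> real" where
  "stopped h l = mtransform (\<lambda>i x. of_bool (alive h l i x)) h"

lemma dyadic_step_all:
  "(\<And>j. j \<in> A \<Longrightarrow> dyadic_step n (P j)) \<Longrightarrow> dyadic_step n (\<lambda>x. \<forall>j\<in>A. P j x)"
  unfolding dyadic_step_def by (intro ballI impI ball_cong refl) metis

lemma alive_step:
  assumes "tree_martingale h"
  shows "dyadic_step i (alive h l i)"
proof -
  have "dyadic_step i (\<lambda>x. \<forall>j\<in>{..i}. \<bar>h j x\<bar> + \<bar>h (Suc j) x - h j x\<bar> \<le> l)"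
  proof (rule dyadic_step_all)
    fix j assume "j \<in> {..i}"
    then have "j \<le> i" by simp
    then show "dyadic_step i (\<lambda>x. \<bar>h j x\<bar> + \<bar>h (Suc j) x - h j x\<bar> \<le> l)"
      using dyadic_step_comp2[OF tree_martingale_step[OF assms, of j i]
          dyadic_step_mono[OF tree_martingale_abs_incr_step[OF assms, of j]], of "\<lambda>u v. \<bar>u\<bar> + v \<le> l"] by simp
  qed
  then show ?thesis by (simp add: alive_def[abs_def] Ball_def)
qed

lemma alive_antimono: "alive h l i x \<Longrightarrow> j \<le> i \<Longrightarrow> alive h l j x"
  by (auto simp: alive_def)

lemma alive_mono: "alive h l i x \<Longrightarrow> l \<le> l' \<Longrightarrow> alive h l' i x"
  by (force simp: alive_def)

lemma stopped_eq:
  assumes "h 0 x = 0" "\<And>i. i < n \<Longrightarrow> alive h l i x"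
  shows "stopped h l n x = h n x"
proof -
  have "stopped h l n x = (\<Sum>i<n. h (Suc i) x - h i x)"
    unfolding stopped_def mtransform_def using assms(2) by (intro sum.cong) auto
  then show ?thesis using assms(1) sum_lessThan_telescope[of "\<lambda>i. h i x" n] by simp
qed

lemma stopped_bound:
  assumes "h 0 x = 0" "0 \<le> l"
  shows "\<bar>stopped h l n x\<bar> \<le> l"
proof (induction n)
  case 0
  then show ?case using assms by (simp add: stopped_def mtransform_def)
next
  case (Suc n)
  show ?case
  proof (cases "alive h l n x")
    case True
    then have "\<bar>h n x\<bar> + \<bar>h (Suc n) x - h n x\<bar> \<le> l" by (simp add: alive_def)
    moreover have "stopped h l (Suc n) x = h (Suc n) x"
      using assms(1) by (rule stopped_eq) (use alive_antimono[OF True] in auto)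
    ultimately show ?thesis by linarith
  next
    case False
    then show ?thesis using Suc by (simp add: stopped_def mtransform_def)
  qed
qed

text \<open>The stopping time of level \<open>l\<close> takes the value \<open>m\<close> at \<open>x\<close>.\<close>

definition stops_at :: "(nat \<Rightarrow> real \<Rightarrow> real) \<Rightarrow> real \<Rightarrow> nat \<Rightarrow> real \<Rightarrow> bool" where
  "stops_at h l m x \<longleftrightarrow> \<not> alive h l m x \<and> (\<forall>i<m. alive h l i x)"

lemma stops_at_step:
  assumes "tree_martingale h"
  shows "dyadic_step m (stops_at h l m)"
proof -
  have "dyadic_step m (\<lambda>x. \<forall>i\<in>{..<m}. alive h l i x)"
    by (rule dyadic_step_all, rule dyadic_step_mono[OF alive_step[OF assms]]) auto
  from dyadic_step_comp2[OF alive_step[OF assms] this, of "\<lambda>u v. \<not> u \<and> v"]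
  show ?thesis by (simp add: stops_at_def[abs_def] Ball_def)
qed

lemma sum_stops_at: "(\<Sum>m<N. of_bool (stops_at h l m x)) = (of_bool (\<exists>i<N. \<not> alive h l i x) :: real)"
proof (induction N)
  case (Suc N)
  then show ?case by (auto simp: stops_at_def less_Suc_eq)
qed simp

lemma sum_stopping_cells:
  assumes h: "tree_martingale h" and t: "t \<in> {0..<1}"
  shows "(\<Sum>c\<in>{c\<in>grid m. stops_at h l m c}. cell_ind m c t) = of_bool (stops_at h l m t)"
proof -
  obtain c0 where c0: "c0 \<in> grid m" "\<lfloor>2 ^ m * c0\<rfloor> = \<lfloor>2 ^ m * t\<rfloor>" using unit_grid[OF t] .
  have "(\<Sum>c\<in>{c\<in>grid m. stops_at h l m c}. cell_ind m c t)
      = (\<Sum>c\<in>{c\<in>grid m. stops_at h l m c}. if c = c0 then 1 else 0)"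
  proof (intro sum.cong refl)
    fix c assume "c \<in> {c\<in>grid m. stops_at h l m c}"
    then have "\<lfloor>2 ^ m * t\<rfloor> = \<lfloor>2 ^ m * c\<rfloor> \<longleftrightarrow> c = c0"
      using c0 grid_inj[of c m c0] by auto
    then show "cell_ind m c t = (if c = c0 then 1 else 0)" by simp
  qed
  also have "\<dots> = of_bool (stops_at h l m c0)" using c0(1) by simp
  also have "stops_at h l m c0 = stops_at h l m t"
    by (rule dyadic_stepD[OF stops_at_step[OF h] grid_unit[OF c0(1)] t c0(2)])
  finally show ?thesis .
qed

text \<open>The difference of the martingales stopped at levels \<open>l \<le> u\<close> is a sum of atoms of height \<open>u + l\<close> on the
  intervals where stopping at level \<open>l\<close> occurs; a point where \<open>h\<close> is not stopped lies outside all of them.\<close>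

lemma fejer_layer:
  assumes h: "tree_martingale h" and h0: "\<And>t. h 0 t = 0" and l: "0 \<le> l" "l \<le> u"
    and x: "x \<in> {0..<1}" "\<And>i. i < N \<Longrightarrow> alive h l i x" and n: "n \<le> 2 ^ N"
  shows "\<bar>grid_mean N (\<lambda>t. (stopped h u N t - stopped h l N t) * fejer_sum n x t)\<bar>
    \<le> real n * (\<Sum>m<N. \<Sum>c\<in>{c\<in>grid m. stops_at h l m c}. (u + l) * atom_bound m x c)"
proof -
  define b where "b t = stopped h u N t - stopped h l N t" for t
  define T where "T m = {c\<in>grid m. stops_at h l m c}" for m
  have bt: "b t = (\<Sum>m<N. \<Sum>c\<in>T m. cell_ind m c t * b t)" if t: "t \<in> {0..<1}" for t
  proof -
    have "(\<Sum>m<N. \<Sum>c\<in>T m. cell_ind m c t * b t) = (\<Sum>m<N. (\<Sum>c\<in>T m. cell_ind m c t)) * b t"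
      by (simp only: sum_distrib_right)
    also have "(\<Sum>m<N. (\<Sum>c\<in>T m. cell_ind m c t)) = of_bool (\<exists>i<N. \<not> alive h l i t)"
      unfolding T_def sum_stopping_cells[OF h t] by (rule sum_stops_at)
    also have "of_bool (\<exists>i<N. \<not> alive h l i t) * b t = b t"
    proof (cases "\<exists>i<N. \<not> alive h l i t")
      case False
      then have "stopped h l N t = h N t" "stopped h u N t = h N t"
        using alive_mono[OF _ l(2)] by (auto intro!: stopped_eq h0)
      then show ?thesis by (simp add: b_def)
    qed simp
    finally show ?thesis by simp
  qed
  have piece: "\<bar>grid_mean N (\<lambda>t. (cell_ind m c t * b t) * fejer_sum n x t)\<bar> \<le> real n * ((u + l) * atom_bound m x c)"
    if m: "m < N" and c: "c \<in> T m" for m c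
  proof (rule fejer_atom)
    have cg: "c \<in> grid m" and cs: "stops_at h l m c" using c by (auto simp: T_def)
    show "c \<in> grid m" by fact
    show "m \<le> N" using m by simp
    show "cell_ind m c t * b t = 0" if "\<lfloor>2 ^ m * t\<rfloor> \<noteq> \<lfloor>2 ^ m * c\<rfloor>" for t using that by simp
    show "\<bar>cell_ind m c t * b t\<bar> \<le> u + l" for t
      using stopped_bound[of h t u N, OF h0] stopped_bound[of h t l N, OF h0] l by (auto simp: b_def)
    show "x \<in> {0..<1}" "n \<le> 2 ^ N" by fact+
    show "\<lfloor>2 ^ m * x\<rfloor> \<noteq> \<lfloor>2 ^ m * c\<rfloor>"
    proof
      assume "\<lfloor>2 ^ m * x\<rfloor> = \<lfloor>2 ^ m * c\<rfloor>"
      then have "stops_at h l m x"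
        using dyadic_stepD[OF stops_at_step[OF h] x(1) grid_unit[OF cg]] cs by blast
      then show False using x(2)[OF m] by (simp add: stops_at_def)
    qed
    \<comment> \<open>Each piece is itself a martingale transform, because before time \<open>m\<close> neither stopping time has
      occurred on the interval; hence it has mean zero.\<close>
    define v where "v i t = cell_ind m c t * (of_bool (alive h u i t) - of_bool (alive h l i t))" for i t
    have v: "dyadic_step i (v i)" for i
    proof (cases "m \<le> i")
      case True
      show ?thesis unfolding v_def[abs_def]
        by (intro dyadic_step_comp2[OF cell_ind_step[OF True], where F = "(*)"]
            dyadic_step_comp2[OF alive_step[OF h] alive_step[OF h], where F = "\<lambda>p q. of_bool p - of_bool q"])
    next
      case False
      have "v i t = 0" if t: "t \<in> {0..<1}" for t
      proof (cases "\<lfloor>2 ^ m * t\<rfloor> = \<lfloor>2 ^ m * c\<rfloor>")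
        case True
        have "alive h l i c" using cs False by (simp add: stops_at_def)
        then have "alive h l i t"
          using dyadic_stepD[OF dyadic_step_mono[OF alive_step[OF h], of i m] t grid_unit[OF cg] True] False by simp
        then show ?thesis using alive_mono[OF _ l(2)] by (simp add: v_def)
      qed (simp add: v_def)
      then show ?thesis by (simp add: dyadic_step_def)
    qed
    have "(\<lambda>t. cell_ind m c t * b t) = mtransform v h N"
      by (simp add: fun_eq_iff b_def stopped_def mtransform_def v_def sum_distrib_left
          sum_subtractf[symmetric] algebra_simps)
    then show "grid_mean N (\<lambda>t. cell_ind m c t * b t) = 0" using mtransform_mean[of h v N, OF h v] by simp
  qed
  have "grid_mean N (\<lambda>t. b t * fejer_sum n x t)
      = grid_mean N (\<lambda>t. \<Sum>m<N. \<Sum>c\<in>T m. (cell_ind m c t * b t) * fejer_sum n x t)"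
  proof (rule grid_mean_cong)
    fix t assume "t \<in> grid N"
    from bt[OF grid_unit[OF this]]
    have "b t * fejer_sum n x t = (\<Sum>m<N. \<Sum>c\<in>T m. cell_ind m c t * b t) * fejer_sum n x t" by (rule arg_cong)
    then show "b t * fejer_sum n x t = (\<Sum>m<N. \<Sum>c\<in>T m. (cell_ind m c t * b t) * fejer_sum n x t)"
      by (simp only: sum_distrib_right)
  qed
  also have "\<dots> = (\<Sum>m<N. \<Sum>c\<in>T m. grid_mean N (\<lambda>t. (cell_ind m c t * b t) * fejer_sum n x t))"
    by (simp only: grid_mean_sum)
  also have "\<bar>\<dots>\<bar> \<le> (\<Sum>m<N. \<Sum>c\<in>T m. real n * ((u + l) * atom_bound m x c))"
    by (intro order_trans[OF sum_abs] sum_mono piece) auto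
  also have "\<dots> = real n * (\<Sum>m<N. \<Sum>c\<in>T m. (u + l) * atom_bound m x c)"
    by (simp only: sum_distrib_left)
  finally show ?thesis by (simp only: b_def T_def)
qed

text \<open>The maximal function restricted to times up to \<open>N\<close>.\<close>

definition running_max :: "(nat \<Rightarrow> real \<Rightarrow> real) \<Rightarrow> nat \<Rightarrow> real \<Rightarrow> real" where
  "running_max h N x = Max ((\<lambda>n. \<bar>h n x\<bar>) ` {..N})"

lemma running_max_ge: "n \<le> N \<Longrightarrow> \<bar>h n x\<bar> \<le> running_max h N x"
  unfolding running_max_def by (rule Max_ge) auto

lemma running_max_nonneg: "0 \<le> running_max h N x"
  using running_max_ge[of 0 N h x] by linarith

lemma running_max_attained: obtains n where "n \<le> N" "running_max h N x = \<bar>h n x\<bar>"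
proof -
  have "running_max h N x \<in> (\<lambda>n. \<bar>h n x\<bar>) ` {..N}"
    unfolding running_max_def by (rule Max_in) auto
  then show ?thesis using that by auto
qed

lemma not_alive_running_max:
  assumes "\<not> alive h l i x" "i < N"
  shows "l < 3 * running_max h N x"
proof -
  obtain j where j: "j \<le> i" "l < \<bar>h j x\<bar> + \<bar>h (Suc j) x - h j x\<bar>" using assms(1) by (auto simp: alive_def not_le)
  then show ?thesis using running_max_ge[of j N h x] running_max_ge[of "Suc j" N h x] assms(2) by linarith
qed

lemma layer_sum:
  fixes e M q :: real
  assumes q: "0 < q" and e: "0 < e" and M: "0 \<le> M"
  shows "(\<Sum>k<L. (e * 2 ^ k) powr q * of_bool (e * 2 ^ k < M)) \<le> (2 * M) powr q / (2 powr q - 1)"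
proof (induction L)
  case 0
  then show ?case using q by (simp add: ge_one_powr_ge_zero)
next
  case (Suc L)
  have B: "1 < 2 powr q" using q by simp
  show ?case
  proof (cases "e * 2 ^ L < M")
    case True
    have "(\<Sum>k<Suc L. (e * 2 ^ k) powr q * of_bool (e * 2 ^ k < M)) \<le> (\<Sum>k<Suc L. (e * 2 ^ k) powr q)"
      by (intro sum_mono) auto
    also have "\<dots> = e powr q * (\<Sum>k<Suc L. (2 powr q) ^ k)"
      unfolding sum_distrib_left using e powr_pow2[of e _ q]
      by (intro sum.cong) (simp_all add: mult.commute)
    also have "(\<Sum>k<Suc L. (2 powr q) ^ k) = ((2 powr q) ^ Suc L - 1) / (2 powr q - 1)"
    proof -
      have "(2 powr q - 1) * (\<Sum>k<Suc L. (2 powr q) ^ k) = (2 powr q) ^ Suc L - 1"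
        by (rule power_diff_1_eq[symmetric])
      then show ?thesis using B q by (simp only: eq_divide_eq mult.commute) simp
    qed
    also have "e powr q * \<dots> \<le> e powr q * ((2 powr q) ^ Suc L / (2 powr q - 1))"
      using B by (intro mult_left_mono divide_right_mono) auto
    also have "\<dots> = (2 ^ Suc L * e) powr q / (2 powr q - 1)"
      using powr_pow2[of e "Suc L" q] e by (simp add: mult.commute)
    also have "\<dots> \<le> (2 * M) powr q / (2 powr q - 1)"
      using True B e q by (intro divide_right_mono powr_mono2) (auto simp: mult.commute ge_one_powr_ge_zero)
    finally show ?thesis .
  next
    case False
    then show ?thesis using Suc by simp
  qed
qed

text \<open>The constant of the weak type inequality. The first summand accounts for the set where stopping at
  the lowest level occurs, the second for the atoms.\<close>

definition weak_const :: "real \<Rightarrow> real" where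
  "weak_const q = 3 powr q + 3 powr q * atom_const q * (6 powr q / (2 powr q - 1))"

lemma weak_const_nonneg: "1 / 2 < q \<Longrightarrow> 0 \<le> weak_const q"
  unfolding weak_const_def using ge_one_powr_ge_zero[of 2 q] atom_const_nonneg[of q]
  by (intro add_nonneg_nonneg mult_nonneg_nonneg divide_nonneg_nonneg) auto

text \<open>The levels are \<open>e 2\<^sup>k\<close>, of which finitely many suffice up to time \<open>N\<close>. Where stopping at level
  \<open>e\<close> does not occur, the Fejer means are at most \<open>4 e + Z\<close>, where \<open>Z\<close> sums the bounds for all atoms.\<close>

lemma fejer_weak_type:
  assumes h: "tree_martingale h" and h0: "\<And>t. h 0 t = 0" and e: "0 < e" and q: "1 / 2 < q" "q \<le> 1"
  shows "grid_mean N (\<lambda>x. of_bool (\<exists>n\<in>{1..2 ^ N}. 5 * e * real n < \<bar>grid_mean N (\<lambda>t. h N t * fejer_sum n x t)\<bar>))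
    \<le> weak_const q / e powr q * grid_mean N (\<lambda>x. running_max h N x powr q)"
proof -
  define l where "l k = e * 2 ^ k" for k :: nat
  have l0: "0 \<le> l k" "0 < l k" for k using e by (auto simp: l_def)
  have l_Suc: "l (Suc k) = 2 * l k" for k by (simp add: l_def)
  define T where "T k m = {c\<in>grid m. stops_at h (l k) m c}" for k m
  define M where "M x = running_max h N x" for x
  have M0: "0 \<le> M x" for x by (simp add: M_def running_max_nonneg)
  have q0: "0 < q" using q by simp
  obtain L :: nat where L: "3 * (\<Sum>t\<in>grid N. M t) / e < 2 ^ L" using real_arch_pow[of 2] by auto
  define Z where "Z x = (\<Sum>k<L. \<Sum>m<N. \<Sum>c\<in>T k m. (3 * l k) * atom_bound m x c)" for x
  have Z0: "0 \<le> Z x" for x unfolding Z_def using l0 by (intro sum_nonneg mult_nonneg_nonneg atom_bound_nonneg) auto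
  have last: "stopped h (l L) N t = h N t" if t: "t \<in> grid N" for t
  proof (rule stopped_eq[of h, OF h0])
    fix i assume i: "i < N"
    have "M t \<le> (\<Sum>t\<in>grid N. M t)" using t M0 by (intro member_le_sum) auto
    moreover have "3 * (\<Sum>t\<in>grid N. M t) < l L" using L e by (simp add: l_def field_simps)
    ultimately show "alive h (l L) i t" using not_alive_running_max[OF _ i, of h "l L" t] unfolding M_def by linarith
  qed
  have good: "\<bar>grid_mean N (\<lambda>t. h N t * fejer_sum n x t)\<bar> \<le> real n * (4 * e + Z x)"
    if x: "x \<in> grid N" and al: "\<And>i. i < N \<Longrightarrow> alive h e i x" and n: "n \<le> 2 ^ N" for x n
  proof -
    let ?F = "fejer_sum n x"
    have "grid_mean N (\<lambda>t. h N t * ?F t) = grid_mean N (\<lambda>t. stopped h (l 0) N t * ?F t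
        + (\<Sum>k<L. (stopped h (l (Suc k)) N t - stopped h (l k) N t) * ?F t))"
    proof (rule grid_mean_cong)
      fix t assume t: "t \<in> grid N"
      have "(\<Sum>k<L. (stopped h (l (Suc k)) N t - stopped h (l k) N t) * ?F t)
          = (stopped h (l L) N t - stopped h (l 0) N t) * ?F t"
        unfolding sum_distrib_right[symmetric]
        by (simp only: sum_lessThan_telescope[of "\<lambda>k. stopped h (l k) N t"])
      then show "h N t * ?F t = stopped h (l 0) N t * ?F t
        + (\<Sum>k<L. (stopped h (l (Suc k)) N t - stopped h (l k) N t) * ?F t)"
        using last[OF t] by (simp add: algebra_simps)
    qed
    then have eq: "grid_mean N (\<lambda>t. h N t * ?F t) = grid_mean N (\<lambda>t. stopped h (l 0) N t * ?F t)
        + (\<Sum>k<L. grid_mean N (\<lambda>t. (stopped h (l (Suc k)) N t - stopped h (l k) N t) * ?F t))"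
      by (simp only: grid_mean_add grid_mean_sum)
    have "\<bar>grid_mean N (\<lambda>t. h N t * ?F t)\<bar> \<le> 4 * e * real n + (\<Sum>k<L. real n * (\<Sum>m<N. \<Sum>c\<in>T k m. (3 * l k) * atom_bound m x c))"
      unfolding eq
    proof (rule order_trans[OF abs_triangle_ineq], rule add_mono)
      show "\<bar>grid_mean N (\<lambda>t. stopped h (l 0) N t * ?F t)\<bar> \<le> 4 * e * real n"
        using stopped_bound[of h _ e, OF h0] e by (intro fejer_bounded n) (auto simp: l_def)
      have "\<bar>grid_mean N (\<lambda>t. (stopped h (l (Suc k)) N t - stopped h (l k) N t) * ?F t)\<bar>
          \<le> real n * (\<Sum>m<N. \<Sum>c\<in>T k m. (3 * l k) * atom_bound m x c)" for k
      proof -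
        have "e \<le> l k" using e by (simp add: l_def)
        then have "\<bar>grid_mean N (\<lambda>t. (stopped h (l (Suc k)) N t - stopped h (l k) N t) * ?F t)\<bar>
          \<le> real n * (\<Sum>m<N. \<Sum>c\<in>T k m. (l (Suc k) + l k) * atom_bound m x c)"
          unfolding T_def using l0[of k] alive_mono[OF al]
          by (intro fejer_layer[OF h h0 _ _ grid_unit[OF x] _ n]) (auto simp: l_Suc)
        then show ?thesis by (simp add: l_Suc)
      qed
      then show "\<bar>\<Sum>k<L. grid_mean N (\<lambda>t. (stopped h (l (Suc k)) N t - stopped h (l k) N t) * ?F t)\<bar>
         \<le> (\<Sum>k<L. real n * (\<Sum>m<N. \<Sum>c\<in>T k m. (3 * l k) * atom_bound m x c))"
        by (intro order_trans[OF sum_abs] sum_mono)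
    qed
    also have "\<dots> = real n * (4 * e + Z x)"
      unfolding Z_def sum_distrib_left[symmetric] distrib_left by (simp only: mult.commute)
    finally show ?thesis .
  qed
  have Zq: "grid_mean N (\<lambda>x. Z x powr q) \<le> 3 powr q * atom_const q * grid_mean N (\<lambda>x. (6 * M x) powr q / (2 powr q - 1))"
  proof -
    have "grid_mean N (\<lambda>x. Z x powr q)
      \<le> grid_mean N (\<lambda>x. \<Sum>k<L. \<Sum>m<N. \<Sum>c\<in>T k m. (3 * l k) powr q * atom_bound m x c powr q)"
    proof (rule grid_mean_mono)
      fix x
      have "Z x powr q \<le> (\<Sum>k<L. (\<Sum>m<N. \<Sum>c\<in>T k m. (3 * l k) * atom_bound m x c) powr q)"
        unfolding Z_def using l0 q
        by (intro powr_sum_subadd) (auto intro!: sum_nonneg mult_nonneg_nonneg atom_bound_nonneg)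
      also have "\<dots> \<le> (\<Sum>k<L. \<Sum>m<N. (\<Sum>c\<in>T k m. (3 * l k) * atom_bound m x c) powr q)"
        using l0 q by (intro sum_mono powr_sum_subadd) (auto intro!: sum_nonneg mult_nonneg_nonneg atom_bound_nonneg)
      also have "\<dots> \<le> (\<Sum>k<L. \<Sum>m<N. \<Sum>c\<in>T k m. ((3 * l k) * atom_bound m x c) powr q)"
        using l0 q by (intro sum_mono powr_sum_subadd) (auto simp: T_def intro!: mult_nonneg_nonneg atom_bound_nonneg)
      also have "\<dots> = (\<Sum>k<L. \<Sum>m<N. \<Sum>c\<in>T k m. (3 * l k) powr q * atom_bound m x c powr q)"
        using l0 by (simp add: powr_mult atom_bound_nonneg)
      finally show "Z x powr q \<le> \<dots>" .
    qed
    also have "\<dots> = (\<Sum>k<L. \<Sum>m<N. \<Sum>c\<in>T k m. (3 * l k) powr q * grid_mean N (\<lambda>x. atom_bound m x c powr q))"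
      by (simp only: grid_mean_sum grid_mean_cmult)
    also have "\<dots> \<le> (\<Sum>k<L. \<Sum>m<N. \<Sum>c\<in>T k m. (3 * l k) powr q * (atom_const q / 2 ^ m))"
      using q by (intro sum_mono mult_left_mono grid_mean_atom_bound) auto
    also have "\<dots> = (\<Sum>k<L. (3 * l k) powr q * atom_const q * (\<Sum>m<N. grid_mean m (\<lambda>c. of_bool (stops_at h (l k) m c))))"
    proof -
      have "(\<Sum>c\<in>T k m. (3 * l k) powr q * (atom_const q / 2 ^ m))
          = (3 * l k) powr q * atom_const q * grid_mean m (\<lambda>c. of_bool (stops_at h (l k) m c))" for k m
        by (simp add: T_def grid_mean_def Int_def)
      then show ?thesis by (simp only: sum_distrib_left)
    qed
    also have "\<dots> = (\<Sum>k<L. (3 * l k) powr q * atom_const q * grid_mean N (\<lambda>x. of_bool (\<exists>i<N. \<not> alive h (l k) i x)))"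
    proof -
      have "(\<Sum>m<N. grid_mean m (\<lambda>c. of_bool (stops_at h (l k) m c))) = (\<Sum>m<N. grid_mean N (\<lambda>c. of_bool (stops_at h (l k) m c)))" for k
        by (intro sum.cong refl grid_mean_step[symmetric] dyadic_step_comp[OF stops_at_step[OF h]]) auto
      then show ?thesis by (simp only: grid_mean_sum[symmetric] sum_stops_at)
    qed
    also have "\<dots> = 3 powr q * atom_const q * grid_mean N (\<lambda>x. \<Sum>k<L. l k powr q * of_bool (\<exists>i<N. \<not> alive h (l k) i x))"
      unfolding grid_mean_sum grid_mean_cmult sum_distrib_left
      using l0 by (intro sum.cong refl) (simp only: powr_mult mult_ac)
    also have "\<dots> \<le> 3 powr q * atom_const q * grid_mean N (\<lambda>x. (6 * M x) powr q / (2 powr q - 1))"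
    proof (intro mult_left_mono grid_mean_mono)
      fix x
      have "(\<Sum>k<L. l k powr q * of_bool (\<exists>i<N. \<not> alive h (l k) i x)) \<le> (\<Sum>k<L. (e * 2 ^ k) powr q * of_bool (e * 2 ^ k < 3 * M x))"
        using not_alive_running_max[of h _ _ x N] by (intro sum_mono mult_mono) (auto simp: l_def M_def)
      also have "\<dots> \<le> (2 * (3 * M x)) powr q / (2 powr q - 1)" by (rule layer_sum) (use q0 e M0 in auto)
      finally show "(\<Sum>k<L. l k powr q * of_bool (\<exists>i<N. \<not> alive h (l k) i x)) \<le> (6 * M x) powr q / (2 powr q - 1)" by simp
    qed (use q atom_const_nonneg in auto)
    finally show ?thesis .
  qed
  have "grid_mean N (\<lambda>x. of_bool (\<exists>n\<in>{1..2 ^ N}. 5 * e * real n < \<bar>grid_mean N (\<lambda>t. h N t * fejer_sum n x t)\<bar>))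
      \<le> grid_mean N (\<lambda>x. (3 powr q / e powr q) * M x powr q + (1 / e powr q) * Z x powr q)"
  proof (rule grid_mean_mono)
    fix x assume x: "x \<in> grid N"
    have nn: "0 \<le> (3 powr q / e powr q) * M x powr q + (1 / e powr q) * Z x powr q" by simp
    have "1 \<le> (3 powr q / e powr q) * M x powr q + (1 / e powr q) * Z x powr q"
      if n: "n \<in> {1..2 ^ N}" "5 * e * real n < \<bar>grid_mean N (\<lambda>t. h N t * fejer_sum n x t)\<bar>" for n
    proof (cases "\<forall>i<N. alive h e i x")
      case True
      then have "\<bar>grid_mean N (\<lambda>t. h N t * fejer_sum n x t)\<bar> \<le> real n * (4 * e + Z x)"
        using n(1) by (intro good[OF x]) auto
      with n(2) have "5 * e * real n < real n * (4 * e + Z x)" by (rule less_le_trans)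
      then have "real n * (5 * e) < real n * (4 * e + Z x)" by (simp add: algebra_simps)
      then have "5 * e < 4 * e + Z x" using n(1) by (subst (asm) mult_less_cancel_left_pos) auto
      then have "e powr q \<le> Z x powr q" using e q0 by (intro powr_mono2) auto
      then have "1 \<le> (1 / e powr q) * Z x powr q" using e by (simp add: field_simps)
      then show ?thesis by (simp add: add_increasing)
    next
      case False
      then have "e < 3 * M x" using not_alive_running_max[of h e _ x N] by (auto simp: M_def)
      then have "e powr q \<le> (3 * M x) powr q" using e q0 by (intro powr_mono2) auto
      then have "1 \<le> (3 powr q / e powr q) * M x powr q" using e M0 by (simp add: field_simps powr_mult)
      then show ?thesis by (simp add: add_increasing2)
    qed
    then show "of_bool (\<exists>n\<in>{1..2 ^ N}. 5 * e * real n < \<bar>grid_mean N (\<lambda>t. h N t * fejer_sum n x t)\<bar>)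
      \<le> (3 powr q / e powr q) * M x powr q + (1 / e powr q) * Z x powr q"
      using nn by (auto simp del: divide_const_simps)
  qed
  also have "\<dots> = (3 powr q / e powr q) * grid_mean N (\<lambda>x. M x powr q) + (1 / e powr q) * grid_mean N (\<lambda>x. Z x powr q)"
    by (simp only: grid_mean_add grid_mean_cmult)
  also have "\<dots> \<le> (3 powr q / e powr q) * grid_mean N (\<lambda>x. M x powr q)
      + (1 / e powr q) * (3 powr q * atom_const q * grid_mean N (\<lambda>x. (6 * M x) powr q / (2 powr q - 1)))"
    using Zq by (intro add_left_mono mult_left_mono) auto
  also have "grid_mean N (\<lambda>x. (6 * M x) powr q / (2 powr q - 1)) = (6 powr q / (2 powr q - 1)) * grid_mean N (\<lambda>x. M x powr q)"
    using M0 by (simp add: grid_mean_cmult[symmetric] powr_mult)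
  also have "(3 powr q / e powr q) * grid_mean N (\<lambda>x. M x powr q)
      + (1 / e powr q) * (3 powr q * atom_const q * ((6 powr q / (2 powr q - 1)) * grid_mean N (\<lambda>x. M x powr q)))
    = weak_const q / e powr q * grid_mean N (\<lambda>x. M x powr q)"
    by (simp add: weak_const_def add_divide_distrib distrib_right mult.assoc)
  finally show ?thesis by (simp only: M_def)
qed

lemma mtransform_energy:
  assumes h: "tree_martingale h" and v: "\<And>i. dyadic_step i (v i)"
  shows "grid_mean N (\<lambda>x. (mtransform v h N x)\<^sup>2) = (\<Sum>i<N. grid_mean (Suc i) (\<lambda>x. (v i x * (h (Suc i) x - h i x))\<^sup>2))"
proof (induction N)
  case 0
  then show ?case by (simp add: mtransform_def)
next
  case (Suc N)
  let ?g = "mtransform v h"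
  have g: "tree_martingale ?g" by (rule tree_martingale_mtransform[OF h v])
  have S: "?g (Suc N) x = ?g N x + v N x * (h (Suc N) x - h N x)" for x by (simp add: mtransform_def)
  have "grid_mean (Suc N) (\<lambda>x. (?g (Suc N) x)\<^sup>2)
      = grid_mean (Suc N) (\<lambda>x. (?g N x)\<^sup>2 + ((v N x * (h (Suc N) x - h N x))\<^sup>2
          + (2 * ?g N x * v N x) * (h (Suc N) x - h N x)))"
    unfolding S by (rule arg_cong[of _ _ "grid_mean _"]) (simp add: fun_eq_iff power2_eq_square algebra_simps)
  also have "\<dots> = grid_mean (Suc N) (\<lambda>x. (?g N x)\<^sup>2) + (grid_mean (Suc N) (\<lambda>x. (v N x * (h (Suc N) x - h N x))\<^sup>2)
     + grid_mean (Suc N) (\<lambda>x. (2 * ?g N x * v N x) * (h (Suc N) x - h N x)))"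
    by (simp only: grid_mean_add)
  also have "grid_mean (Suc N) (\<lambda>x. (2 * ?g N x * v N x) * (h (Suc N) x - h N x)) = 0"
    by (rule tree_martingale_incr_mean[OF h dyadic_step_comp2[OF tree_martingale_step[OF g order_refl] v, where F = "\<lambda>u w. 2 * u * w"]]) simp
  also have "grid_mean (Suc N) (\<lambda>x. (?g N x)\<^sup>2) = grid_mean N (\<lambda>x. (?g N x)\<^sup>2)"
    by (rule grid_mean_step[OF dyadic_step_comp[OF tree_martingale_step[OF g order_refl]]]) simp
  finally show ?case using Suc by simp
qed

text \<open>Kolmogorov's maximal inequality for martingale transforms: the transform is stopped once it exceeds
  \<open>d\<close>, which can only decrease the sum of the squares of its increments.\<close>

lemma maximal_L2:
  assumes h: "tree_martingale h" and v: "\<And>i. dyadic_step i (v i)" and d: "0 < d"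
  shows "grid_mean N (\<lambda>x. of_bool (\<exists>n\<le>N. d < \<bar>mtransform v h n x\<bar>))
    \<le> (\<Sum>i<N. grid_mean (Suc i) (\<lambda>x. (v i x * (h (Suc i) x - h i x))\<^sup>2)) / d\<^sup>2"
proof -
  define g where "g = mtransform v h"
  have g: "tree_martingale g" unfolding g_def by (rule tree_martingale_mtransform[OF h v])
  define al where "al i x = (\<forall>j\<in>{..i}. \<bar>g j x\<bar> \<le> d)" for i x
  have al: "dyadic_step i (al i)" for i
    unfolding al_def[abs_def]
    by (rule dyadic_step_all, rule dyadic_step_comp[OF tree_martingale_step[OF g], of _ _ "\<lambda>u. \<bar>u\<bar> \<le> d"]) simp
  define w where "w i x = of_bool (al i x) * v i x" for i x
  have w: "dyadic_step i (w i)" for i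
    unfolding w_def[abs_def] by (rule dyadic_step_comp2[OF al v, where F = "\<lambda>u v. of_bool u * v"])
  have hit: "d < \<bar>mtransform w h N x\<bar>" if ex: "\<exists>n\<le>N. d < \<bar>g n x\<bar>" for x
  proof -
    define n where "n = (LEAST n. d < \<bar>g n x\<bar>)"
    obtain n' where n': "n' \<le> N" "d < \<bar>g n' x\<bar>" using ex by blast
    have n: "d < \<bar>g n x\<bar>" unfolding n_def using n'(2) by (rule LeastI)
    have nN: "n \<le> N" using n' Least_le[of "\<lambda>n. d < \<bar>g n x\<bar>" n'] unfolding n_def by linarith
    have before: "al i x" if "i < n" for i
      unfolding al_def
    proof
      fix j assume "j \<in> {..i}"
      then have "j < n" using that by simp
      then have "\<not> d < \<bar>g j x\<bar>" unfolding n_def by (rule not_less_Least)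
      then show "\<bar>g j x\<bar> \<le> d" by simp
    qed
    have after: "\<not> al i x" if "n \<le> i" for i 
    proof
      assume "al i x"
      then have "\<bar>g n x\<bar> \<le> d" using that by (simp add: al_def)
      then show False using n by simp
    qed
    have "mtransform w h N x = (\<Sum>i<n. w i x * (h (Suc i) x - h i x))"
      unfolding mtransform_def using nN after by (intro sum.mono_neutral_right) (auto simp: w_def)
    also have "\<dots> = g n x" unfolding g_def mtransform_def using before by (intro sum.cong) (auto simp: w_def)
    finally show ?thesis using n by simp
  qed
  have "grid_mean N (\<lambda>x. of_bool (\<exists>n\<le>N. d < \<bar>g n x\<bar>)) \<le> grid_mean N (\<lambda>x. (1 / d\<^sup>2) * (mtransform w h N x)\<^sup>2)"
  proof (rule grid_mean_mono)
    fix x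
    show "of_bool (\<exists>n\<le>N. d < \<bar>g n x\<bar>) \<le> (1 / d\<^sup>2) * (mtransform w h N x)\<^sup>2"
    proof (cases "\<exists>n\<le>N. d < \<bar>g n x\<bar>")
      case True
      have "d\<^sup>2 \<le> (mtransform w h N x)\<^sup>2" using hit[OF True] d by (simp add: abs_le_square_iff[symmetric])
      then show ?thesis using d by (simp add: field_simps)
    next
      case False
      show ?thesis by (simp only: False of_bool_eq) simp
    qed
  qed
  also have "\<dots> = (\<Sum>i<N. grid_mean (Suc i) (\<lambda>x. (w i x * (h (Suc i) x - h i x))\<^sup>2)) / d\<^sup>2"
    by (simp only: grid_mean_cmult mtransform_energy[OF h w]) simp
  also have "\<dots> \<le> (\<Sum>i<N. grid_mean (Suc i) (\<lambda>x. (v i x * (h (Suc i) x - h i x))\<^sup>2)) / d\<^sup>2"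
    by (intro divide_right_mono sum_mono grid_mean_mono) (auto simp: w_def)
  finally show ?thesis by (simp only: g_def)
qed

section \<open>Passage to Lebesgue measure\<close>

lemma space_unit_leb [simp]: "space unit_leb = {0..<1}"
  by (simp add: unit_leb_def space_restrict_space)

lemma emeasure_unit_leb:
  "A \<subseteq> {0..<1} \<Longrightarrow> emeasure unit_leb A = emeasure lebesgue A"
  unfolding unit_leb_def by (rule emeasure_restrict_space) auto

lemma interval_unit_leb: "{a..<b} \<subseteq> {0..<1::real} \<Longrightarrow> {a..<b} \<in> sets unit_leb"
  by (auto simp: unit_leb_def sets_restrict_space)

lemma finite_measure_unit_leb: "finite_measure unit_leb"
  by (rule finite_measureI) (simp add: emeasure_unit_leb)

lemma grid_cell_iff:
  assumes "c \<in> grid n"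
  shows "\<lfloor>2 ^ n * x\<rfloor> = \<lfloor>2 ^ n * c\<rfloor> \<longleftrightarrow> x \<in> {c..<c + 1 / 2 ^ n}"
proof -
  have "\<lfloor>2 ^ n * x\<rfloor> = \<lfloor>2 ^ n * c\<rfloor> \<longleftrightarrow> 2 ^ n * c \<le> 2 ^ n * x \<and> 2 ^ n * x < 2 ^ n * c + 1"
    using grid_floor[OF assms] by (metis floor_eq_iff)
  also have "\<dots> \<longleftrightarrow> x \<in> {c..<c + 1 / 2 ^ n}" by (auto simp: field_simps)
  finally show ?thesis .
qed

lemma grid_cell_subset:
  assumes "c \<in> grid n"
  shows "{c..<c + 1 / 2 ^ n} \<subseteq> {0..<1}"
proof -
  obtain k where k: "k < 2 ^ n" "c = real k / 2 ^ n" using assms by (auto simp: grid_def)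
  have "Suc k \<le> 2 ^ n" using k(1) by simp
  then have "real (Suc k) \<le> 2 ^ n" by (metis of_nat_le_iff of_nat_numeral of_nat_power)
  then have "c + 1 / 2 ^ n \<le> 1" by (simp add: k(2) field_simps)
  then show ?thesis using grid_unit[OF assms] by auto
qed

lemma measure_grid_cell: "c \<in> grid n \<Longrightarrow> measure unit_leb {c..<c + 1 / 2 ^ n} = 1 / 2 ^ n"
  using grid_cell_subset[of c n] by (simp add: measure_def emeasure_unit_leb)

lemma dyadic_step_expand:
  fixes g :: "real \<Rightarrow> real"
  assumes "dyadic_step n g" "x \<in> {0..<1}"
  shows "g x = (\<Sum>c\<in>grid n. g c * indicator {c..<c + 1 / 2 ^ n} x)"
proof -
  obtain c0 where c0: "c0 \<in> grid n" "\<lfloor>2 ^ n * c0\<rfloor> = \<lfloor>2 ^ n * x\<rfloor>" using unit_grid[OF assms(2)] .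
  have "(\<Sum>c\<in>grid n. g c * indicator {c..<c + 1 / 2 ^ n} x) = (\<Sum>c\<in>grid n. if c = c0 then g c0 else 0)"
  proof (intro sum.cong refl)
    fix c assume c: "c \<in> grid n"
    have "x \<in> {c..<c + 1 / 2 ^ n} \<longleftrightarrow> c = c0"
      using grid_cell_iff[OF c, of x] grid_inj[OF c c0(1)] c0(2) by auto
    then show "g c * indicator {c..<c + 1 / 2 ^ n} x = (if c = c0 then g c0 else 0)"
      by (auto simp: indicator_def)
  qed
  also have "\<dots> = g c0" using c0(1) by simp
  also have "g c0 = g x" by (rule dyadic_stepD[OF assms(1) grid_unit[OF c0(1)] assms(2) c0(2)])
  finally show ?thesis by simp
qed

lemma has_bochner_integral_dyadic_step:
  assumes "dyadic_step n g"
  shows "has_bochner_integral unit_leb g (grid_mean n g)"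
proof -
  interpret finite_measure unit_leb by (rule finite_measure_unit_leb)
  have "has_bochner_integral unit_leb (\<lambda>x. \<Sum>c\<in>grid n. g c * indicator {c..<c + 1 / 2 ^ n} x)
      (\<Sum>c\<in>grid n. g c * measure unit_leb {c..<c + 1 / 2 ^ n})"
    by (intro has_bochner_integral_sum has_bochner_integral_mult_right has_bochner_integral_real_indicator
        interval_unit_leb grid_cell_subset) (auto simp: less_top[symmetric])
  also have "(\<Sum>c\<in>grid n. g c * measure unit_leb {c..<c + 1 / 2 ^ n}) = grid_mean n g"
    unfolding grid_mean_def sum_divide_distrib by (intro sum.cong refl) (simp add: measure_grid_cell)
  finally show ?thesis
    by (subst has_bochner_integral_cong[OF refl _ refl]) (use dyadic_step_expand[OF assms] in auto)
qed

lemma integral_dyadic_step: "dyadic_step n g \<Longrightarrow> (\<integral>x. g x \<partial>unit_leb) = grid_mean n g"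
  by (rule has_bochner_integral_integral_eq[OF has_bochner_integral_dyadic_step])

lemma integrable_dyadic_step: "dyadic_step n g \<Longrightarrow> integrable unit_leb g" for g :: "real \<Rightarrow> real"
  by (rule integrable.intros[OF has_bochner_integral_dyadic_step])

lemma measurable_dyadic_step: "dyadic_step n g \<Longrightarrow> g \<in> borel_measurable unit_leb" for g :: "real \<Rightarrow> real"
  using integrable_dyadic_step by blast

lemma nn_integral_dyadic_step:
  assumes "dyadic_step n g" "\<And>x. 0 \<le> g x"
  shows "(\<integral>\<^sup>+x. ennreal (g x) \<partial>unit_leb) = ennreal (grid_mean n g)"
  using nn_integral_eq_integral[OF integrable_dyadic_step[OF assms(1)]] assms(2)
  by (simp add: integral_dyadic_step[OF assms(1)])

lemma emeasure_dyadic_step: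
  assumes "dyadic_step n P"
  shows "{x\<in>{0..<1}. P x} \<in> sets unit_leb"
    "emeasure unit_leb {x\<in>{0..<1}. P x} = ennreal (grid_mean n (\<lambda>x. of_bool (P x)))"
proof -
  have st: "dyadic_step n (\<lambda>x. of_bool (P x) :: real)" by (rule dyadic_step_comp[OF assms])
  note [measurable] = measurable_dyadic_step[OF st]
  have "{x\<in>space unit_leb. of_bool (P x) = (1::real)} \<in> sets unit_leb" by measurable
  then show s: "{x\<in>{0..<1}. P x} \<in> sets unit_leb" by simp
  have "emeasure unit_leb {x\<in>{0..<1}. P x} = (\<integral>\<^sup>+x. indicator {x\<in>{0..<1}. P x} x \<partial>unit_leb)"
    using s by simp
  also have "\<dots> = (\<integral>\<^sup>+x. ennreal (of_bool (P x)) \<partial>unit_leb)"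
    by (rule nn_integral_cong) (auto simp: indicator_def)
  also have "\<dots> = ennreal (grid_mean n (\<lambda>x. of_bool (P x)))" by (rule nn_integral_dyadic_step[OF st]) simp
  finally show "emeasure unit_leb {x\<in>{0..<1}. P x} = ennreal (grid_mean n (\<lambda>x. of_bool (P x)))" .
qed

lemma walsh_coeff_tree_martingale:
  assumes h: "tree_martingale h" and i: "i < 2 ^ N"
  shows "walsh_coeff h i = grid_mean N (\<lambda>t. h N t * walsh i t)"
proof -
  have "(\<integral>x. h k x * walsh i x \<partial>unit_leb) = grid_mean N (\<lambda>t. h N t * walsh i t)" if k: "N \<le> k" for k
  proof -
    have w: "dyadic_step N (walsh i)" by (rule walsh_step[OF i])
    have "(\<integral>x. h k x * walsh i x \<partial>unit_leb) = grid_mean k (\<lambda>x. h k x * walsh i x)"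
      by (rule integral_dyadic_step[OF dyadic_step_comp2[OF tree_martingale_step[OF h order_refl] dyadic_step_mono[OF w k]]])
    also have "\<dots> = grid_mean N (\<lambda>x. h N x * walsh i x)"
      using tree_martingale_mean[OF h w k] by (simp add: mult.commute)
    finally show ?thesis .
  qed
  then have "\<forall>\<^sub>F k in sequentially. (\<integral>x. h k x * walsh i x \<partial>unit_leb) = grid_mean N (\<lambda>t. h N t * walsh i t)"
    unfolding eventually_sequentially by blast
  then show ?thesis unfolding walsh_coeff_def by (intro limI tendsto_eventually)
qed

lemma fejer_mean_tree_martingale:
  assumes h: "tree_martingale h" and n: "n \<le> 2 ^ N"
  shows "fejer_mean h n x = grid_mean N (\<lambda>t. h N t * fejer_sum n x t) / real n"
proof -
  have "(\<Sum>k=1..n. walsh_partial_sum h k x)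
      = (\<Sum>k=1..n. \<Sum>i<k. grid_mean N (\<lambda>t. h N t * walsh i t) * walsh i x)"
    unfolding walsh_partial_sum_def using n
    by (intro sum.cong refl) (auto simp: walsh_coeff_tree_martingale[OF h])
  also have "\<dots> = (\<Sum>k=1..n. \<Sum>i<k. grid_mean N (\<lambda>t. h N t * (walsh i x * walsh i t)))"
    by (intro sum.cong refl) (simp add: grid_mean_cmult[symmetric] mult_ac)
  also have "\<dots> = grid_mean N (\<lambda>t. h N t * fejer_sum n x t)"
    by (simp only: fejer_sum_def dirichlet_def sum_distrib_left grid_mean_sum)
  finally show ?thesis by (simp add: fejer_mean_def)
qed

lemma dyadic_interval_subset: "k < 2 ^ n \<Longrightarrow> dyadic_interval n k \<subseteq> {0..<1}"
proof -
  assume k: "k < 2 ^ n"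
  then have "real k / 2 ^ n \<in> grid n" by (simp add: grid_def)
  from grid_cell_subset[OF this] show "dyadic_interval n k \<subseteq> {0..<1}"
    by (simp add: dyadic_interval_def add_divide_distrib)
qed

lemma sets_dyadic_algebra: "sets (dyadic_algebra n) = sigma_sets {0..<1} {dyadic_interval n k | k. k < 2 ^ n}"
  unfolding dyadic_algebra_def by (rule sets_measure_of) (use dyadic_interval_subset in auto)

lemma space_dyadic_algebra [simp]: "space (dyadic_algebra n) = {0..<1}"
  unfolding dyadic_algebra_def by (rule space_measure_of) (use dyadic_interval_subset in auto)

text \<open>Sets of the dyadic \<open>\<sigma>\<close>-algebra of level \<open>n\<close> do not separate points of one interval of that level, so
  measurable functions are step functions everywhere and not only almost everywhere.\<close>

lemma dyadic_algebra_cell: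
  assumes "A \<in> sets (dyadic_algebra n)" "x \<in> {0..<1}" "y \<in> {0..<1}" "\<lfloor>2 ^ n * x\<rfloor> = \<lfloor>2 ^ n * y\<rfloor>"
  shows "x \<in> A \<longleftrightarrow> y \<in> A"
proof -
  have di: "z \<in> dyadic_interval n k \<longleftrightarrow> \<lfloor>2 ^ n * z\<rfloor> = int k" for z k
  proof -
    have "\<lfloor>2 ^ n * z\<rfloor> = int k \<longleftrightarrow> real k \<le> 2 ^ n * z \<and> 2 ^ n * z < real k + 1" by (simp add: floor_eq_iff)
    also have "\<dots> \<longleftrightarrow> z \<in> dyadic_interval n k" by (auto simp: dyadic_interval_def field_simps)
    finally show ?thesis by simp
  qed
  have "A \<in> sigma_sets {0..<1} {dyadic_interval n k | k. k < 2 ^ n}"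
    using assms(1) by (simp add: sets_dyadic_algebra)
  then show ?thesis
  proof (induction rule: sigma_sets.induct)
    case (Basic a)
    then show ?case using di assms(4) by auto
  qed (use assms(2,3) in auto)
qed

lemma subalgebra_dyadic: "subalgebra unit_leb (dyadic_algebra n)"
proof -
  have "{dyadic_interval n k | k. k < 2 ^ n} \<subseteq> sets unit_leb"
    using interval_unit_leb dyadic_interval_subset unfolding dyadic_interval_def by blast
  then have "sigma_sets (space unit_leb) {dyadic_interval n k | k. k < 2 ^ n} \<subseteq> sets unit_leb"
    by (rule sets.sigma_sets_subset)
  then show ?thesis by (simp add: subalgebra_def sets_dyadic_algebra)
qed

lemma tree_martingale_of_dyadic_martingale:
  assumes f: "dyadic_martingale f"
  shows "tree_martingale f"
proof -
  have st: "dyadic_step n (f n)" for n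
    unfolding dyadic_step_def
  proof (intro ballI impI)
    fix x y :: real assume xy: "x \<in> {0..<1}" "y \<in> {0..<1}" "\<lfloor>2 ^ n * x\<rfloor> = \<lfloor>2 ^ n * y\<rfloor>"
    have [measurable]: "f n \<in> borel_measurable (dyadic_algebra n)" using f by (simp add: dyadic_martingale_def)
    have "{z \<in> space (dyadic_algebra n). f n z = f n x} \<in> sets (dyadic_algebra n)" by measurable
    from dyadic_algebra_cell[OF this xy] show "f n x = f n y" using xy by auto
  qed
  have "f (Suc n) c + f (Suc n) (c + 1 / 2 ^ Suc n) = 2 * f n c" if c: "c \<in> grid n" for n c
  proof -
    interpret finite_measure unit_leb by (rule finite_measure_unit_leb)
    interpret finite_measure_subalgebra unit_leb "dyadic_algebra n"
      by unfold_locales (rule subalgebra_dyadic)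
    let ?A = "{c..<c + 1 / 2 ^ n}"
    obtain k where k: "k < 2 ^ n" "c = real k / 2 ^ n" using c by (auto simp: grid_def)
    have "?A = dyadic_interval n k" by (simp add: dyadic_interval_def k(2) add_divide_distrib)
    then have A: "?A \<in> sets (dyadic_algebra n)" using k(1) by (auto simp: sets_dyadic_algebra)
    have AM: "?A \<in> sets unit_leb" by (rule interval_unit_leb[OF grid_cell_subset[OF c]])
    have ind: "indicator ?A x = (cell_ind n c x :: real)" for x
      using grid_cell_iff[OF c, of x] by (simp add: indicator_def)
    have int: "(\<integral>x\<in>?A. f m x \<partial>unit_leb) = grid_mean m (\<lambda>x. cell_ind n c x * f m x)" if "n \<le> m" for m
      unfolding set_lebesgue_integral_def ind
      using integral_dyadic_step[OF dyadic_step_comp2[OF cell_ind_step[OF that] st], of "(*)" c] by simp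
    have "grid_mean (Suc n) (\<lambda>x. cell_ind n c x * f (Suc n) x) = (\<integral>x\<in>?A. f (Suc n) x \<partial>unit_leb)"
      by (rule int[symmetric]) simp
    also have "\<dots> = (\<integral>x\<in>?A. real_cond_exp unit_leb (dyadic_algebra n) (f (Suc n)) x \<partial>unit_leb)"
      using f A by (intro real_cond_exp_intA) (auto simp: dyadic_martingale_def)
    also have "\<dots> = (\<integral>x\<in>?A. f n x \<partial>unit_leb)"
    proof (rule set_lebesgue_integral_cong_AE[OF AM])
      show "f n \<in> borel_measurable unit_leb" by (rule measurable_dyadic_step[OF st])
      have "AE x in unit_leb. real_cond_exp unit_leb (dyadic_algebra n) (f (Suc n)) x = f n x"
        using f le_SucI[OF order_refl, of n] unfolding dyadic_martingale_def by blast
      then show "AE x\<in>?A in unit_leb. real_cond_exp unit_leb (dyadic_algebra n) (f (Suc n)) x = f n x"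
        by (rule AE_mp) simp
    qed simp
    also have "\<dots> = f n c / 2 ^ n" using int[of n] grid_mean_cell_mult[OF st c] by simp
    also have "grid_mean (Suc n) (\<lambda>x. cell_ind n c x * f (Suc n) x)
       = grid_mean n (\<lambda>x. if x = c then (f (Suc n) c + f (Suc n) (c + 1 / 2 ^ Suc n)) / 2 else 0)"
      unfolding grid_mean_Suc
    proof (rule grid_mean_cong)
      fix x assume x: "x \<in> grid n"
      have "\<lfloor>2 ^ n * x\<rfloor> = \<lfloor>2 ^ n * c\<rfloor> \<longleftrightarrow> x = c" using grid_inj[OF x c] by auto
      then show "(cell_ind n c x * f (Suc n) x
          + cell_ind n c (x + 1 / 2 ^ Suc n) * f (Suc n) (x + 1 / 2 ^ Suc n)) / 2
        = (if x = c then (f (Suc n) c + f (Suc n) (c + 1 / 2 ^ Suc n)) / 2 else 0)"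
        unfolding grid_half(2)[OF x] by simp
    qed
    also have "\<dots> = (f (Suc n) c + f (Suc n) (c + 1 / 2 ^ Suc n)) / 2 / 2 ^ n"
      using c by (simp add: grid_mean_def)
    finally have "(f (Suc n) c + f (Suc n) (c + 1 / 2 ^ Suc n)) / 2 = f n c"
      by (subst (asm) divide_cancel_right) auto
    moreover have "u = 2 * w" if "u / 2 = w" for u w :: real using that by simp
    ultimately show ?thesis by blast
  qed
  then show ?thesis using st by (simp add: tree_martingale_def)
qed

lemma AE_escape:
  assumes B: "\<And>J. B J \<in> sets M" and le: "\<And>J. emeasure M (B J) \<le> c J" and c: "c \<longlonglongrightarrow> 0"
  shows "AE x in M. \<exists>J. x \<notin> B J"
proof -
  have "emeasure M (\<Inter>J. B J) \<le> c J" for J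
    using le[of J] emeasure_mono[of "\<Inter>J. B J" "B J" M] B by (force intro: order_trans)
  then have "emeasure M (\<Inter>J. B J) \<le> 0"
    using LIMSEQ_le_const[OF c] by blast
  moreover have "(\<Inter>J. B J) \<in> sets M" using B by blast
  ultimately show ?thesis by (intro AE_I[of _ _ "\<Inter>J. B J"]) auto
qed

lemma emeasure_incseq_le:
  assumes "\<And>N. B N \<in> sets M" "incseq B" "\<And>N. emeasure M (B N) \<le> c"
  shows "emeasure M (\<Union>N. B N) \<le> c"
proof -
  have "emeasure M (\<Union>N. B N) = (SUP N. emeasure M (B N))"
    using assms(1,2) by (intro SUP_emeasure_incseq[symmetric]) auto
  also have "\<dots> \<le> c" using assms(3) by (rule SUP_least)
  finally show ?thesis .
qed

section \<open>Almost everywhere convergence of martingales\<close>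

lemma maximal_L2_measure:
  assumes h: "tree_martingale h" and v: "\<And>i. dyadic_step i (v i)" and d: "0 < d"
    and E: "\<And>N. (\<Sum>i<N. grid_mean (Suc i) (\<lambda>x. (v i x * (h (Suc i) x - h i x))\<^sup>2)) \<le> E"
  shows "{x\<in>{0..<1}. \<exists>n. d < \<bar>mtransform v h n x\<bar>} \<in> sets unit_leb"
    "emeasure unit_leb {x\<in>{0..<1}. \<exists>n. d < \<bar>mtransform v h n x\<bar>} \<le> ennreal (E / d\<^sup>2)"
proof -
  define P where "P N x = (\<exists>n\<le>N. d < \<bar>mtransform v h n x\<bar>)" for N x
  have P: "dyadic_step N (P N)" for N
  proof -
    have "dyadic_step N (\<lambda>x. \<forall>n\<in>{..N}. \<not> d < \<bar>mtransform v h n x\<bar>)"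
      by (rule dyadic_step_all, rule dyadic_step_comp[OF tree_martingale_step[OF tree_martingale_mtransform[OF h v]], where F = "\<lambda>u. \<not> d < \<bar>u\<bar>"]) simp
    from dyadic_step_comp[OF this, of Not] show ?thesis by (simp add: P_def[abs_def] Bex_def)
  qed
  have eq: "{x\<in>{0..<1}. \<exists>n. d < \<bar>mtransform v h n x\<bar>} = (\<Union>N. {x\<in>{0..<1}. P N x})"
    by (auto simp: P_def)
  show "{x\<in>{0..<1}. \<exists>n. d < \<bar>mtransform v h n x\<bar>} \<in> sets unit_leb"
    unfolding eq using emeasure_dyadic_step(1)[OF P] by blast
  show "emeasure unit_leb {x\<in>{0..<1}. \<exists>n. d < \<bar>mtransform v h n x\<bar>} \<le> ennreal (E / d\<^sup>2)"
    unfolding eq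
  proof (rule emeasure_incseq_le)
    show "incseq (\<lambda>N. {x\<in>{0..<1}. P N x})"
      by (auto simp: incseq_def P_def intro: order_trans)
    fix N
    show "{x\<in>{0..<1}. P N x} \<in> sets unit_leb" by (rule emeasure_dyadic_step(1)[OF P])
    have "grid_mean N (\<lambda>x. of_bool (P N x)) \<le> E / d\<^sup>2"
      unfolding P_def by (rule order_trans[OF maximal_L2[OF h v d] divide_right_mono[OF E]]) auto
    then show "emeasure unit_leb {x\<in>{0..<1}. P N x} \<le> ennreal (E / d\<^sup>2)"
      unfolding emeasure_dyadic_step(2)[OF P] by (rule ennreal_leI)
  qed
qed

lemma mtransform_tail:
  "mtransform (\<lambda>i x. of_bool (J \<le> i) * v i x) h n x = mtransform v h n x - mtransform v h (min n J) x"
proof -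
  have "mtransform v h n x = (\<Sum>i<n. of_bool (J \<le> i) * v i x * (h (Suc i) x - h i x))
      + (\<Sum>i<n. of_bool (i < J) * (v i x * (h (Suc i) x - h i x)))"
    unfolding mtransform_def sum.distrib[symmetric] by (intro sum.cong) auto
  also have "(\<Sum>i<n. of_bool (i < J) * (v i x * (h (Suc i) x - h i x))) = mtransform v h (min n J) x"
    unfolding mtransform_def by (intro sum.mono_neutral_cong_right) auto
  finally show ?thesis by (simp add: mtransform_def)
qed

lemma CauchyI_inverse:
  fixes s :: "nat \<Rightarrow> real"
  assumes "\<And>k::nat. \<exists>J. \<forall>n\<ge>J. \<forall>m\<ge>J. \<bar>s n - s m\<bar> \<le> C / real (Suc k)"
  shows "convergent s"
proof -
  have "Cauchy s"
  proof (rule CauchyI)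
    fix e :: real assume e: "0 < e"
    obtain k :: nat where k: "C / e < real k" using reals_Archimedean2 by blast
    have "C < e * real (Suc k)" using k e by (simp add: field_simps)
    then have "C / real (Suc k) < e" by (simp add: field_simps)
    then show "\<exists>M. \<forall>m\<ge>M. \<forall>n\<ge>M. norm (s m - s n) < e"
      using assms[of k] by (metis le_less_trans real_norm_def)
  qed
  then show ?thesis by (rule Cauchy_convergent)
qed

lemma AE_convergent_stopped:
  assumes h: "tree_martingale h" and h0: "\<And>x. h 0 x = 0" and l: "0 \<le> l"
  shows "AE x in unit_leb. convergent (\<lambda>n. stopped h l n x)"
proof -
  define v where "v i x = (of_bool (alive h l i x) :: real)" for i x
  have v: "dyadic_step i (v i)" for i unfolding v_def[abs_def] by (rule dyadic_step_comp[OF alive_step[OF h]])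
  have S: "stopped h l = mtransform v h" by (simp add: stopped_def v_def[abs_def])
  define a where "a i = grid_mean (Suc i) (\<lambda>x. (v i x * (h (Suc i) x - h i x))\<^sup>2)" for i
  have a0: "0 \<le> a i" for i unfolding a_def by (rule grid_mean_nonneg) simp
  have "(\<Sum>i<N. a i) \<le> l\<^sup>2" for N
  proof -
    have "(\<Sum>i<N. a i) = grid_mean N (\<lambda>x. (stopped h l N x)\<^sup>2)"
      unfolding S a_def by (rule mtransform_energy[OF h v, symmetric])
    also have "\<dots> \<le> grid_mean N (\<lambda>x. l\<^sup>2)"
      using stopped_bound[of h _ l N, OF h0 l] l by (intro grid_mean_mono) (simp add: abs_le_square_iff[symmetric])
    finally show ?thesis by simp
  qed
  then have sa: "summable a" using a0 by (intro summableI_nonneg_bounded[of a "l\<^sup>2"])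
  define r where "r J = (\<Sum>i. a (i + J))" for J
  have r: "r \<longlonglongrightarrow> 0" unfolding r_def by (rule suminf_exist_split2[OF sa])
  define w where "w J i x = of_bool (J \<le> i) * v i x" for J i x
  have w: "dyadic_step i (w J i)" for J i unfolding w_def by (rule dyadic_step_comp[OF v])
  have energy: "(\<Sum>i<N. grid_mean (Suc i) (\<lambda>x. (w J i x * (h (Suc i) x - h i x))\<^sup>2)) \<le> r J" for J N
  proof -
    have "(\<Sum>i<N. grid_mean (Suc i) (\<lambda>x. (w J i x * (h (Suc i) x - h i x))\<^sup>2)) = (\<Sum>i<N. if J \<le> i then a i else 0)"
      by (intro sum.cong) (auto simp: w_def a_def)
    also have "\<dots> = (\<Sum>i\<in>{J..<N}. a i)"
      by (intro sum.mono_neutral_cong_right) auto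
    also have "\<dots> \<le> (\<Sum>i\<in>{0 + J..<N + J}. a i)" using a0 by (intro sum_mono2) auto
    also have "\<dots> = (\<Sum>i<N. a (i + J))" unfolding sum.shift_bounds_nat_ivl by (simp add: atLeast0LessThan)
    also have "\<dots> \<le> r J" unfolding r_def
      using a0 summable_ignore_initial_segment[OF sa] by (intro sum_le_suminf) auto
    finally show ?thesis .
  qed
  have "AE x in unit_leb. \<exists>J. \<forall>n. \<bar>mtransform (w J) h n x\<bar> \<le> 1 / real (Suc k)" for k
  proof -
    define d where "d = 1 / real (Suc k)"
    have d: "0 < d" by (simp add: d_def)
    let ?B = "\<lambda>J. {x\<in>{0..<1}. \<exists>n. d < \<bar>mtransform (w J) h n x\<bar>}"
    have lim: "(\<lambda>J. ennreal (r J / d\<^sup>2)) \<longlonglongrightarrow> 0"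
      using tendsto_ennrealI[OF tendsto_divide[OF r tendsto_const[of "d\<^sup>2"]]] d by simp
    have "AE x in unit_leb. \<exists>J. x \<notin> ?B J"
      by (rule AE_escape[OF maximal_L2_measure(1)[OF h w d energy] maximal_L2_measure(2)[OF h w d energy] lim])
    then show ?thesis by (rule AE_mp) (auto simp: not_less d_def intro!: AE_I2)
  qed
  then have "AE x in unit_leb. \<forall>k. \<exists>J. \<forall>n. \<bar>mtransform (w J) h n x\<bar> \<le> 1 / real (Suc k)"
    unfolding AE_all_countable by blast
  then show ?thesis
  proof (rule AE_mp, intro AE_I2 impI)
    fix x assume x: "\<forall>k. \<exists>J. \<forall>n. \<bar>mtransform (w J) h n x\<bar> \<le> 1 / real (Suc k)"
    show "convergent (\<lambda>n. stopped h l n x)"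
    proof (rule CauchyI_inverse[of _ 2])
      fix k
      obtain J where J: "\<And>n. \<bar>mtransform (w J) h n x\<bar> \<le> 1 / real (Suc k)" using x by blast
      have "\<bar>stopped h l n x - stopped h l m x\<bar> \<le> 2 / real (Suc k)" if "J \<le> n" "J \<le> m" for n m
      proof -
        have e: "mtransform (w J) h i x = stopped h l i x - stopped h l J x" if "J \<le> i" for i
          using mtransform_tail[of J v h i x] that by (simp add: w_def[abs_def] S min_def)
        have "\<bar>stopped h l n x - stopped h l m x\<bar> \<le> 1 / real (Suc k) + 1 / real (Suc k)"
          using J[of n] J[of m] e[OF that(1)] e[OF that(2)] by linarith
        also have "\<dots> = 2 / real (Suc k)" by (simp add: field_simps)
        finally show ?thesis .
      qed
      then show "\<exists>J. \<forall>n\<ge>J. \<forall>m\<ge>J. \<bar>stopped h l n x - stopped h l m x\<bar> \<le> 2 / real (Suc k)" by blast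
    qed
  qed
qed

lemma AE_convergent_bounded:
  assumes h: "tree_martingale h" and h0: "\<And>x. h 0 x = 0"
  shows "AE x in unit_leb. (\<exists>C. \<forall>n. \<bar>h n x\<bar> \<le> C) \<longrightarrow> convergent (\<lambda>n. h n x)"
proof -
  have "AE x in unit_leb. \<forall>k::nat. convergent (\<lambda>n. stopped h (real k) n x)"
    unfolding AE_all_countable by (intro allI AE_convergent_stopped[OF h h0]) simp
  then show ?thesis
  proof (rule AE_mp, intro AE_I2 impI)
    fix x assume x: "\<forall>k::nat. convergent (\<lambda>n. stopped h (real k) n x)" and "\<exists>C. \<forall>n. \<bar>h n x\<bar> \<le> C"
    then obtain C where C: "\<And>n. \<bar>h n x\<bar> \<le> C" by blast
    obtain k :: nat where k: "3 * C < real k" using reals_Archimedean2 by blast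
    have "alive h (real k) i x" for i
      unfolding alive_def
    proof (intro allI impI)
      fix j show "\<bar>h j x\<bar> + \<bar>h (Suc j) x - h j x\<bar> \<le> real k" using C[of j] C[of "Suc j"] k by linarith
    qed
    then have "stopped h (real k) n x = h n x" for n by (intro stopped_eq[of h, OF h0])
    then show "convergent (\<lambda>n. h n x)" using x by (metis (mono_tags, lifting) convergent_cong eventuallyI)
  qed
qed

lemma cesaro_eventually_const:
  fixes s :: "nat \<Rightarrow> real"
  assumes "\<And>k. K \<le> k \<Longrightarrow> s k = c"
  shows "(\<lambda>n. (\<Sum>k=1..n. s k) / real n) \<longlonglongrightarrow> c"
proof -
  define D where "D = (\<Sum>k=1..K. s k - c)"
  have "(\<Sum>k=1..n. s k) / real n = c + D / real n" if n: "n \<ge> Suc K" for n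
  proof -
    have "(\<Sum>k=1..n. s k - c) = D" unfolding D_def
      using n assms by (intro sum.mono_neutral_right) auto
    then have "(\<Sum>k=1..n. s k) = real n * c + D" by (simp add: sum_subtractf)
    then show ?thesis using n by (simp add: field_simps)
  qed
  then have "\<forall>\<^sub>F n in sequentially. c + D / real n = (\<Sum>k=1..n. s k) / real n"
    unfolding eventually_sequentially by (metis (no_types))
  moreover have "(\<lambda>n. c + D / real n) \<longlonglongrightarrow> c + 0"
    by (intro tendsto_add tendsto_const lim_const_over_n)
  ultimately show ?thesis using Lim_transform_eventually by fastforce
qed

section \<open>Almost everywhere convergence of Fejer means\<close>

text \<open>The martingale \<open>f\<close> minus the same martingale frozen at time \<open>J\<close>.\<close>

definition martingale_tail :: "(nat \<Rightarrow> real \<Rightarrow> real) \<Rightarrow> nat \<Rightarrow> nat \<Rightarrow> real \<Rightarrow> real" where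
  "martingale_tail f J n x = f n x - f (min n J) x"

lemma martingale_tail_eq_mtransform: "martingale_tail f J = mtransform (\<lambda>i x. of_bool (J \<le> i)) f"
proof (intro ext)
  fix n x
  have "mtransform (\<lambda>i x. 1) f n x = f n x - f 0 x" for n
    unfolding mtransform_def using sum_lessThan_telescope[of "\<lambda>i. f i x" n] by simp
  then show "martingale_tail f J n x = mtransform (\<lambda>i x. of_bool (J \<le> i)) f n x"
    using mtransform_tail[of J "\<lambda>i x. 1" f n x] by (simp add: martingale_tail_def)
qed

lemma tree_martingale_tail: "tree_martingale f \<Longrightarrow> tree_martingale (martingale_tail f J)"
  unfolding martingale_tail_eq_mtransform by (rule tree_martingale_mtransform) auto

lemma martingale_tail_0 [simp]: "martingale_tail f J 0 x = 0"
  by (simp add: martingale_tail_def)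

lemma grid_mean_step_walsh_zero:
  assumes g: "dyadic_step J g" and i: "2 ^ J \<le> i" and N: "i < 2 ^ N"
  shows "grid_mean N (\<lambda>t. g t * walsh i t) = 0"
proof -
  have "(1::nat) \<le> 2 ^ J" by simp
  then have "1 \<le> i" using i by linarith
  then obtain a where a: "2 ^ a \<le> i" "i < 2 ^ Suc a" by (rule pow2_bracket)
  define k where "k = i - 2 ^ a"
  have ik: "i = 2 ^ a + k" and k: "k < 2 ^ a" using a by (auto simp: k_def)
  have "(2::nat) ^ J < 2 ^ Suc a" using i a(2) by linarith
  then have "J < Suc a" by (rule power_less_imp_less_exp[rotated]) simp
  then have Ja: "J \<le> a" by simp
  have "(2::nat) ^ a < 2 ^ N" using a(1) N by linarith
  then have aN: "Suc a \<le> N" by simp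
  have st: "dyadic_step a (\<lambda>t. g t * walsh k t)"
    by (rule dyadic_step_comp2[OF dyadic_step_mono[OF g Ja] walsh_step[OF k]])
  have r0: "rademacher a 0 = 1" by (simp add: rademacher_def)
  have "grid_mean N (\<lambda>t. g t * walsh i t) = grid_mean (Suc a) (\<lambda>t. g t * walsh i t)"
    by (rule grid_mean_step[OF dyadic_step_comp2[OF dyadic_step_mono[OF g] walsh_step[OF a(2)]] aN]) (use Ja in simp)
  also have "\<dots> = grid_mean (Suc a) (\<lambda>t. g t * walsh k t * rad_mult a 0 t)"
    unfolding ik walsh_add_pow2[OF k] r0 by (simp add: mult_ac)
  also have "\<dots> = grid_mean a (\<lambda>t. (g t * walsh k t * 1 + g t * walsh k t * (- 1)) / 2)"
    by (rule grid_mean_Suc_rad_mult[OF st, where \<Psi> = "\<lambda>u r. u * r"])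
  also have "\<dots> = 0" by simp
  finally show ?thesis .
qed

text \<open>The difference consists of the Fejer means of the Walsh polynomial \<open>f\<^sub>J\<close>, whose partial sums are
  constant from index \<open>2\<^sup>J\<close> on.\<close>

lemma convergent_fejer_mean_diff_martingale_tail:
  assumes f: "tree_martingale f"
  shows "convergent (\<lambda>n. fejer_mean f n x - fejer_mean (martingale_tail f J) n x)"
proof -
  define c where "c i = walsh_coeff f i - walsh_coeff (martingale_tail f J) i" for i
  have c0: "c i = 0" if i: "2 ^ J \<le> i" for i
  proof -
    define N where "N = max J i"
    have "i < 2 ^ i" by (rule less_exp)
    also have "\<dots> \<le> 2 ^ N" by (rule power_increasing) (auto simp: N_def)
    finally have iN: "i < 2 ^ N" .
    have "c i = grid_mean N (\<lambda>t. f N t * walsh i t) - grid_mean N (\<lambda>t. martingale_tail f J N t * walsh i t)"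
      unfolding c_def walsh_coeff_tree_martingale[OF f iN] walsh_coeff_tree_martingale[OF tree_martingale_tail[OF f] iN] ..
    also have "\<dots> = grid_mean N (\<lambda>t. f J t * walsh i t)"
      by (simp add: grid_mean_diff[symmetric] martingale_tail_def N_def min_def algebra_simps max_def)
    also have "\<dots> = 0" by (rule grid_mean_step_walsh_zero[OF tree_martingale_step[OF f order_refl] i iN])
    finally show ?thesis .
  qed
  have "(\<lambda>n. (\<Sum>k=1..n. \<Sum>i<k. c i * walsh i x) / real n) \<longlonglongrightarrow> (\<Sum>i<2 ^ J. c i * walsh i x)"
    by (rule cesaro_eventually_const[where K = "2 ^ J"], rule sum.mono_neutral_right) (auto simp: c0)
  moreover have "fejer_mean f n x - fejer_mean (martingale_tail f J) n x = (\<Sum>k=1..n. \<Sum>i<k. c i * walsh i x) / real n" for n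
    by (simp add: fejer_mean_def walsh_partial_sum_def c_def left_diff_distrib sum_subtractf diff_divide_distrib)
  ultimately show ?thesis by (auto simp: convergent_def)
qed

lemma fejer_weak_type_measure:
  assumes h: "tree_martingale h" and h0: "\<And>t. h 0 t = 0" and e: "0 < e" and q: "1 / 2 < q" "q \<le> 1"
  shows "{x\<in>{0..<1}. \<exists>n\<ge>1. 5 * e < \<bar>fejer_mean h n x\<bar>} \<in> sets unit_leb"
    "emeasure unit_leb {x\<in>{0..<1}. \<exists>n\<ge>1. 5 * e < \<bar>fejer_mean h n x\<bar>}
      \<le> ennreal (weak_const q / e powr q) * (\<integral>\<^sup>+x. (SUP n. ennreal (\<bar>h n x\<bar> powr q)) \<partial>unit_leb)"
proof -
  define P where "P N x = (\<exists>n\<in>{1..2 ^ N}. 5 * e * real n < \<bar>grid_mean N (\<lambda>t. h N t * fejer_sum n x t)\<bar>)" for N x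
  have P_iff: "P N x \<longleftrightarrow> (\<exists>n\<in>{1..2 ^ N}. 5 * e < \<bar>fejer_mean h n x\<bar>)" for N x
    unfolding P_def
  proof (rule bex_cong[OF refl])
    fix n :: nat assume n: "n \<in> {1..2 ^ N}"
    then show "5 * e * real n < \<bar>grid_mean N (\<lambda>t. h N t * fejer_sum n x t)\<bar> \<longleftrightarrow> 5 * e < \<bar>fejer_mean h n x\<bar>"
      by (simp add: fejer_mean_tree_martingale[OF h, of n N] pos_less_divide_eq)
  qed
  have P: "dyadic_step N (P N)" for N
  proof -
    have st: "dyadic_step N (\<lambda>x. grid_mean N (\<lambda>t. h N t * fejer_sum n x t))" if "n \<le> 2 ^ N" for n
      unfolding dyadic_step_def
    proof (intro ballI impI grid_mean_cong)
      fix x y t :: real assume xy: "x \<in> {0..<1}" "y \<in> {0..<1}" "\<lfloor>2 ^ N * x\<rfloor> = \<lfloor>2 ^ N * y\<rfloor>"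
      then have "fejer_sum n t x = fejer_sum n t y" by (rule dyadic_stepD[OF fejer_sum_step[OF that]])
      then show "h N t * fejer_sum n x t = h N t * fejer_sum n y t"
        by (simp only: fejer_sum_commute[of n _ t])
    qed
    have "dyadic_step N (\<lambda>x. \<forall>n\<in>{1..2 ^ N}. \<not> 5 * e * real n < \<bar>grid_mean N (\<lambda>t. h N t * fejer_sum n x t)\<bar>)"
      by (rule dyadic_step_all, rule dyadic_step_comp[OF st, where F = "\<lambda>u. \<not> 5 * e * real _ < \<bar>u\<bar>"]) simp
    from dyadic_step_comp[OF this, of Not] show ?thesis by (simp add: P_def[abs_def])
  qed
  have eq: "{x\<in>{0..<1}. \<exists>n\<ge>1. 5 * e < \<bar>fejer_mean h n x\<bar>} = (\<Union>N. {x\<in>{0..<1}. P N x})"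
  proof -
    have "(\<exists>n\<ge>1. 5 * e < \<bar>fejer_mean h n x\<bar>) \<longleftrightarrow> (\<exists>N. P N x)" for x
    proof
      assume "\<exists>n\<ge>1. 5 * e < \<bar>fejer_mean h n x\<bar>"
      then obtain n where n: "1 \<le> n" "5 * e < \<bar>fejer_mean h n x\<bar>" by blast
      have "n \<le> 2 ^ n" by (rule less_imp_le[OF less_exp])
      then have "n \<in> {1..2 ^ n}" using n(1) by simp
      then show "\<exists>N. P N x" unfolding P_iff using n(2) by blast
    next
      assume "\<exists>N. P N x"
      then obtain N n where "n \<in> {1..2 ^ N}" "5 * e < \<bar>fejer_mean h n x\<bar>" unfolding P_iff by blast
      then show "\<exists>n\<ge>1. 5 * e < \<bar>fejer_mean h n x\<bar>" by (intro exI[of _ n]) simp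
    qed
    then show ?thesis by blast
  qed
  show "{x\<in>{0..<1}. \<exists>n\<ge>1. 5 * e < \<bar>fejer_mean h n x\<bar>} \<in> sets unit_leb"
    unfolding eq using emeasure_dyadic_step(1)[OF P] by blast
  show "emeasure unit_leb {x\<in>{0..<1}. \<exists>n\<ge>1. 5 * e < \<bar>fejer_mean h n x\<bar>}
      \<le> ennreal (weak_const q / e powr q) * (\<integral>\<^sup>+x. (SUP n. ennreal (\<bar>h n x\<bar> powr q)) \<partial>unit_leb)"
    unfolding eq
  proof (rule emeasure_incseq_le)
    show "incseq (\<lambda>N. {x\<in>{0..<1}. P N x})"
    proof (rule incseq_SucI)
      fix N
      have "{1..2 ^ N} \<subseteq> {1..2 ^ Suc N :: nat}" by simp
      then show "{x\<in>{0..<1}. P N x} \<subseteq> {x\<in>{0..<1}. P (Suc N) x}" unfolding P_iff by blast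
    qed
    fix N
    show "{x\<in>{0..<1}. P N x} \<in> sets unit_leb" by (rule emeasure_dyadic_step(1)[OF P])
    have rm: "dyadic_step N (\<lambda>x. running_max h N x powr q)"
    proof -
      have "dyadic_step N (running_max h N)"
        unfolding dyadic_step_def running_max_def
      proof (intro ballI impI)
        fix x y :: real assume xy: "x \<in> {0..<1}" "y \<in> {0..<1}" "\<lfloor>2 ^ N * x\<rfloor> = \<lfloor>2 ^ N * y\<rfloor>"
        have "h n x = h n y" if "n \<le> N" for n by (rule dyadic_stepD[OF tree_martingale_step[OF h that] xy])
        then have "(\<lambda>n. \<bar>h n x\<bar>) ` {..N} = (\<lambda>n. \<bar>h n y\<bar>) ` {..N}" by (intro image_cong) auto
        then show "Max ((\<lambda>n. \<bar>h n x\<bar>) ` {..N}) = Max ((\<lambda>n. \<bar>h n y\<bar>) ` {..N})" by (rule arg_cong)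
      qed
      then show ?thesis by (rule dyadic_step_comp)
    qed
    have "emeasure unit_leb {x\<in>{0..<1}. P N x} = ennreal (grid_mean N (\<lambda>x. of_bool (P N x)))"
      by (rule emeasure_dyadic_step(2)[OF P])
    also have "\<dots> \<le> ennreal (weak_const q / e powr q * grid_mean N (\<lambda>x. running_max h N x powr q))"
      unfolding P_def by (rule ennreal_leI[OF fejer_weak_type[OF h h0 e q]])
    also have "\<dots> = ennreal (weak_const q / e powr q) * (\<integral>\<^sup>+x. ennreal (running_max h N x powr q) \<partial>unit_leb)"
      using weak_const_nonneg[OF q(1)]
      unfolding nn_integral_dyadic_step[OF rm powr_ge_zero] by (intro ennreal_mult') simp
    also have "\<dots> \<le> ennreal (weak_const q / e powr q) * (\<integral>\<^sup>+x. (SUP n. ennreal (\<bar>h n x\<bar> powr q)) \<partial>unit_leb)"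
    proof (intro mult_left_mono nn_integral_mono)
      fix x
      obtain n where "n \<le> N" "running_max h N x = \<bar>h n x\<bar>" by (rule running_max_attained)
      then show "ennreal (running_max h N x powr q) \<le> (SUP n. ennreal (\<bar>h n x\<bar> powr q))"
        by (auto intro: SUP_upper)
    qed simp
    finally show "emeasure unit_leb {x\<in>{0..<1}. P N x} \<le> \<dots>" .
  qed
qed

lemma martingale_tail_maximal_integral_tendsto:
  assumes f: "tree_martingale f" and q: "0 < q" "q \<le> 1"
    and fin: "(\<integral>\<^sup>+x. (SUP n. ennreal (\<bar>f n x\<bar> powr q)) \<partial>unit_leb) < \<infinity>"
  shows "(\<lambda>J. \<integral>\<^sup>+x. (SUP n. ennreal (\<bar>martingale_tail f J n x\<bar> powr q)) \<partial>unit_leb) \<longlonglongrightarrow> 0"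
proof -
  define U where "U x = (SUP n. ennreal (\<bar>f n x\<bar> powr q))" for x
  define u where "u J x = (SUP n. ennreal (\<bar>martingale_tail f J n x\<bar> powr q))" for J x
  have fm [measurable]: "f n \<in> borel_measurable unit_leb" for n
    by (rule measurable_dyadic_step[OF tree_martingale_step[OF f order_refl]])
  have tm [measurable]: "martingale_tail f J n \<in> borel_measurable unit_leb" for J n
    unfolding martingale_tail_def[abs_def] by measurable
  have Um [measurable]: "U \<in> borel_measurable unit_leb" unfolding U_def[abs_def] by measurable
  have um [measurable]: "u J \<in> borel_measurable unit_leb" for J unfolding u_def[abs_def] by measurable
  have U_ge: "ennreal (\<bar>f n x\<bar> powr q) \<le> U x" for n x unfolding U_def by (rule SUP_upper) simp
  have u_le: "u J x \<le> 2 * U x" for J x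
    unfolding u_def
  proof (rule SUP_least)
    fix n
    have "\<bar>martingale_tail f J n x\<bar> powr q \<le> (\<bar>f n x\<bar> + \<bar>f (min n J) x\<bar>) powr q"
      using q by (intro powr_mono2) (auto simp: martingale_tail_def)
    also have "\<dots> \<le> \<bar>f n x\<bar> powr q + \<bar>f (min n J) x\<bar> powr q" using q by (intro powr_subadd) auto
    finally have "ennreal (\<bar>martingale_tail f J n x\<bar> powr q) \<le> ennreal (\<bar>f n x\<bar> powr q) + ennreal (\<bar>f (min n J) x\<bar> powr q)"
      using ennreal_leI[of "\<bar>martingale_tail f J n x\<bar> powr q" "\<bar>f n x\<bar> powr q + \<bar>f (min n J) x\<bar> powr q"] by simp
    also have "\<dots> \<le> U x + U x" by (intro add_mono U_ge)
    finally show "ennreal (\<bar>martingale_tail f J n x\<bar> powr q) \<le> 2 * U x" by (simp add: mult_2)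
  qed
  have "AE x in unit_leb. U x \<noteq> \<infinity>"
    using fin by (intro nn_integral_PInf_AE) (auto simp: U_def[abs_def])
  moreover have "AE x in unit_leb. (\<exists>C. \<forall>n. \<bar>martingale_tail f 0 n x\<bar> \<le> C) \<longrightarrow> convergent (\<lambda>n. martingale_tail f 0 n x)"
    by (rule AE_convergent_bounded[OF tree_martingale_tail[OF f]]) simp
  ultimately have "AE x in unit_leb. (\<lambda>J. u J x) \<longlonglongrightarrow> 0"
  proof eventually_elim
    case (elim x)
    have "\<bar>f n x\<bar> \<le> (enn2real (U x)) powr (1 / q)" for n
    proof -
      have "ennreal (\<bar>f n x\<bar> powr q) \<le> ennreal (enn2real (U x))"
        using U_ge[of n x] elim(1) by (simp add: less_top)
      then have "\<bar>f n x\<bar> powr q \<le> enn2real (U x)" by (simp add: ennreal_le_iff)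
      then have "(\<bar>f n x\<bar> powr q) powr (1 / q) \<le> enn2real (U x) powr (1 / q)"
        using q by (intro powr_mono2) auto
      then show ?thesis using q by (simp add: powr_powr)
    qed
    note b = this
    have "\<bar>martingale_tail f 0 n x\<bar> \<le> 2 * (enn2real (U x)) powr (1 / q)" for n
      using b[of n] b[of 0] by (simp add: martingale_tail_def)
    then have "convergent (\<lambda>n. martingale_tail f 0 n x)" using elim(2) by blast
    then have "Cauchy (\<lambda>n. martingale_tail f 0 n x)" by (rule convergent_Cauchy)
    show ?case
    proof (rule order_tendstoI)
      fix a :: ennreal assume "0 < a"
      then obtain r where r: "0 < r" "r < a" using dense by blast
      obtain s where s: "r = ennreal s" "0 \<le> s" using r by (cases r) auto
      have s0: "0 < s" using r(1) s by simp
      define d where "d = s powr (1 / q)"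
      have d: "0 < d" "d powr q = s" using s0 q by (auto simp: d_def powr_powr)
      obtain M where M: "\<And>m n. M \<le> m \<Longrightarrow> M \<le> n \<Longrightarrow> \<bar>martingale_tail f 0 m x - martingale_tail f 0 n x\<bar> < d"
        using CauchyD[OF \<open>Cauchy _\<close> d(1)] by auto
      have "u J x < a" if J: "M \<le> J" for J
      proof -
        have "u J x \<le> r" unfolding u_def
        proof (rule SUP_least)
          fix n
          have "\<bar>martingale_tail f J n x\<bar> \<le> d"
            using M[of n J] J d(1) by (cases "n \<le> J") (auto simp: martingale_tail_def)
          then have "\<bar>martingale_tail f J n x\<bar> powr q \<le> s" using powr_mono2[of q "\<bar>martingale_tail f J n x\<bar>" d] q d(2) by simp
          then show "ennreal (\<bar>martingale_tail f J n x\<bar> powr q) \<le> r" unfolding s(1) by (rule ennreal_leI)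
        qed
        then show ?thesis using r(2) by simp
      qed
      then show "\<forall>\<^sub>F J in sequentially. u J x < a" unfolding eventually_sequentially by blast
    qed simp
  qed
  moreover have "(\<integral>\<^sup>+x. 2 * U x \<partial>unit_leb) < \<infinity>"
    using fin by (simp add: nn_integral_cmult U_def[symmetric] ennreal_mult_less_top)
  ultimately have "(\<lambda>J. \<integral>\<^sup>+x. u J x \<partial>unit_leb) \<longlonglongrightarrow> (\<integral>\<^sup>+x. 0 \<partial>unit_leb)"
    using u_le by (intro nn_integral_dominated_convergence[where w = "\<lambda>x. 2 * U x"]) auto
  then show ?thesis by (simp add: u_def)
qed

lemma AE_convergent_fejer_mean:
  assumes f: "tree_martingale f" and q: "1 / 2 < q" "q \<le> 1"
    and fin: "(\<integral>\<^sup>+x. (SUP n. ennreal (\<bar>f n x\<bar> powr q)) \<partial>unit_leb) < \<infinity>"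
  shows "AE x in unit_leb. convergent (\<lambda>n. fejer_mean f n x)"
proof -
  have "AE x in unit_leb. \<exists>J. \<forall>n\<ge>1. \<bar>fejer_mean (martingale_tail f J) n x\<bar> \<le> 5 / real (Suc k)" for k
  proof -
    define e where "e = 1 / real (Suc k)"
    have e: "0 < e" by (simp add: e_def)
    let ?B = "\<lambda>J. {x\<in>{0..<1}. \<exists>n\<ge>1. 5 * e < \<bar>fejer_mean (martingale_tail f J) n x\<bar>}"
    let ?c = "\<lambda>J. ennreal (weak_const q / e powr q) * (\<integral>\<^sup>+x. (SUP n. ennreal (\<bar>martingale_tail f J n x\<bar> powr q)) \<partial>unit_leb)"
    have lim: "?c \<longlonglongrightarrow> 0"
      using ennreal_tendsto_cmult[OF ennreal_less_top martingale_tail_maximal_integral_tendsto[OF f _ q(2) fin],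
          of "weak_const q / e powr q"] q by simp
    have "AE x in unit_leb. \<exists>J. x \<notin> ?B J"
      by (rule AE_escape[OF fejer_weak_type_measure(1)[OF tree_martingale_tail[OF f] martingale_tail_0 e q]
            fejer_weak_type_measure(2)[OF tree_martingale_tail[OF f] martingale_tail_0 e q] lim])
    then show ?thesis by (rule AE_mp) (auto simp: not_less e_def intro!: AE_I2)
  qed
  then have "AE x in unit_leb. \<forall>k. \<exists>J. \<forall>n\<ge>1. \<bar>fejer_mean (martingale_tail f J) n x\<bar> \<le> 5 / real (Suc k)"
    unfolding AE_all_countable by blast
  then show ?thesis
  proof (rule AE_mp, intro AE_I2 impI)
    fix x assume x: "\<forall>k. \<exists>J. \<forall>n\<ge>1. \<bar>fejer_mean (martingale_tail f J) n x\<bar> \<le> 5 / real (Suc k)"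
    show "convergent (\<lambda>n. fejer_mean f n x)"
    proof (rule CauchyI_inverse[of _ 11])
      fix k
      obtain J where J: "\<And>n. 1 \<le> n \<Longrightarrow> \<bar>fejer_mean (martingale_tail f J) n x\<bar> \<le> 5 / real (Suc k)" using x by blast
      have "Cauchy (\<lambda>n. fejer_mean f n x - fejer_mean (martingale_tail f J) n x)"
        by (rule convergent_Cauchy[OF convergent_fejer_mean_diff_martingale_tail[OF f]])
      then obtain M where M: "\<And>m n. M \<le> m \<Longrightarrow> M \<le> n \<Longrightarrow>
          \<bar>(fejer_mean f m x - fejer_mean (martingale_tail f J) m x) - (fejer_mean f n x - fejer_mean (martingale_tail f J) n x)\<bar> < 1 / real (Suc k)"
        using CauchyD[of "\<lambda>n. fejer_mean f n x - fejer_mean (martingale_tail f J) n x" "1 / real (Suc k)"]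
        unfolding real_norm_def by force
      have "\<bar>fejer_mean f n x - fejer_mean f m x\<bar> \<le> 11 / real (Suc k)" if "max 1 M \<le> n" "max 1 M \<le> m" for n m
      proof -
        have "\<bar>fejer_mean f n x - fejer_mean f m x\<bar> \<le> 1 / real (Suc k) + 5 / real (Suc k) + 5 / real (Suc k)"
          using M[of n m] J[of n] J[of m] that by linarith
        also have "\<dots> = 11 / real (Suc k)" by (simp flip: add_divide_distrib)
        finally show ?thesis .
      qed
      then show "\<exists>J. \<forall>n\<ge>J. \<forall>m\<ge>J. \<bar>fejer_mean f n x - fejer_mean f m x\<bar> \<le> 11 / real (Suc k)" by blast
    qed
  qed
qed

section \<open>Reduction to a constant exponent\<close>

lemma p_minus_lower_exponent:
  assumes "1 / 2 < p_minus p {0..<1}"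
  obtains q where "1 / 2 < q" "q \<le> 1" "AE x in unit_leb. q \<le> p x"
proof -
  have R: "restrict_space unit_leb {0..<1} = unit_leb"
    by (simp add: unit_leb_def restrict_restrict_space)
  obtain z where z: "1 / 2 < z" "AE x in unit_leb. z \<le> ereal (p x)"
    using assms unfolding p_minus_def essinf_def R less_Sup_iff by auto
  define q where "q = real_of_ereal (min z 1)"
  have half: "(1 / 2 :: ereal) = ereal (1 / 2)" by (simp add: one_ereal_def)
  have "1 / 2 < min z 1" using z(1) by (simp add: half one_ereal_def)
  then have "\<exists>s. min z 1 = ereal s"
    by (cases z; cases "z \<le> 1") (auto simp: one_ereal_def half min_def)
  then obtain s where "min z 1 = ereal s" by blast
  then have e: "ereal q = min z 1" by (simp add: q_def)
  show ?thesis
  proof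
    show "1 / 2 < q" using \<open>1 / 2 < min z 1\<close> unfolding e[symmetric] half by simp
    show "q \<le> 1" using min.cobounded2[of z 1] unfolding e[symmetric] by (simp add: one_ereal_def)
    show "AE x in unit_leb. q \<le> p x"
      using z(2)
    proof eventually_elim
      case (elim x)
      have "ereal q \<le> ereal (p x)" unfolding e using elim by (simp add: min.coboundedI1)
      then show ?case by simp
    qed
  qed
qed

lemma hardy_space_powr_integral:
  assumes p: "p \<in> borel_measurable unit_leb"
    and f: "f \<in> hardy_space p"
    and q: "0 < q" "AE x in unit_leb. q \<le> p x"
  shows "(\<integral>\<^sup>+x. (SUP n. ennreal (\<bar>f n x\<bar> powr q)) \<partial>unit_leb) < \<infinity>"
proof -
  interpret finite_measure unit_leb by (rule finite_measure_unit_leb)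
  have dm: "dyadic_martingale f" and vn: "var_norm p (maximal_function f) < top"
    using f by (auto simp: hardy_space_def)
  have [measurable]: "f n \<in> borel_measurable unit_leb" for n
    using dm unfolding dyadic_martingale_def by blast
  note p [measurable]
  obtain L where L: "0 < L" "L < top"
      "(\<integral>\<^sup>+x. ennreal_powr (maximal_function f x / L) (p x) \<partial>unit_leb) \<le> 1"
    using vn unfolding var_norm_def Inf_less_iff by blast
  obtain l where l: "L = ennreal l" "0 < l" using L(1,2) by (cases L) auto
  define G where "G x = ennreal_powr (maximal_function f x / L) (p x)" for x
  have mm [measurable]: "maximal_function f \<in> borel_measurable unit_leb"
    unfolding maximal_function_def[abs_def] by measurable
  have Gm [measurable]: "G \<in> borel_measurable unit_leb"
    unfolding G_def[abs_def] ennreal_powr_def by measurable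
  have "(\<integral>\<^sup>+x. (SUP n. ennreal (\<bar>f n x\<bar> powr q)) \<partial>unit_leb) \<le> (\<integral>\<^sup>+x. ennreal (l powr q) * (1 + G x) \<partial>unit_leb)"
  proof (rule nn_integral_mono_AE)
    show "AE x in unit_leb. (SUP n. ennreal (\<bar>f n x\<bar> powr q)) \<le> ennreal (l powr q) * (1 + G x)"
      using q(2)
    proof eventually_elim
      case (elim x)
      show ?case
      proof (rule SUP_least)
        fix n
        define y where "y = \<bar>f n x\<bar> / l"
        have y0: "0 \<le> y" using l by (simp add: y_def)
        have yG: "ennreal (y powr p x) \<le> G x"
        proof (cases "maximal_function f x / L = top")
          case True
          then show ?thesis by (simp add: G_def ennreal_powr_def)
        next
          case False
          have "ennreal \<bar>f n x\<bar> \<le> maximal_function f x" unfolding maximal_function_def by (rule SUP_upper) simp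
          then have "ennreal \<bar>f n x\<bar> / L \<le> maximal_function f x / L" by (rule divide_right_mono_ennreal)
          also have "ennreal \<bar>f n x\<bar> / L = ennreal y" using l by (simp add: y_def divide_ennreal)
          finally have "ennreal y \<le> ennreal (enn2real (maximal_function f x / L))"
            using False by (simp add: less_top)
          then have "y \<le> enn2real (maximal_function f x / L)" by (simp add: ennreal_le_iff)
          then have "y powr p x \<le> enn2real (maximal_function f x / L) powr p x"
            using y0 elim q(1) by (intro powr_mono2) auto
          then show ?thesis using False by (simp add: G_def ennreal_powr_def ennreal_leI)
        qed
        have "y powr q \<le> 1 + y powr p x"
        proof (cases "y \<le> 1")
          case True
          then have "y powr q \<le> 1" using y0 q(1) powr_mono2[of q y 1] by simp
          then show ?thesis by (simp add: add_increasing2)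
        next
          case False
          then have "y powr q \<le> y powr p x" using elim by (intro powr_mono) auto
          then show ?thesis by simp
        qed
        then have "ennreal (y powr q) \<le> 1 + ennreal (y powr p x)"
          using ennreal_leI[of "y powr q" "1 + y powr p x"] by simp
        also have "\<dots> \<le> 1 + G x" using yG by (rule add_left_mono)
        finally have "ennreal (l powr q) * ennreal (y powr q) \<le> ennreal (l powr q) * (1 + G x)"
          by (rule mult_left_mono) simp
        moreover have "\<bar>f n x\<bar> powr q = l powr q * y powr q"
          using l y0 by (simp add: powr_mult[symmetric] y_def)
        ultimately show "ennreal (\<bar>f n x\<bar> powr q) \<le> ennreal (l powr q) * (1 + G x)"
          by (simp add: ennreal_mult)
      qed
    qed
  qed
  also have "\<dots> = ennreal (l powr q) * (emeasure unit_leb (space unit_leb) + (\<integral>\<^sup>+x. G x \<partial>unit_leb))"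
    by (simp add: nn_integral_cmult nn_integral_add)
  also have "\<dots> < \<infinity>"
  proof -
    have "(\<integral>\<^sup>+x. G x \<partial>unit_leb) < top"
      using L(3) by (simp add: G_def order_le_less_trans[OF _ ennreal_one_less_top])
    moreover have "emeasure unit_leb (space unit_leb) < top"
      using emeasure_finite[of "space unit_leb"] by (simp only: less_top)
    ultimately show ?thesis by (simp only: ennreal_mult_less_top ennreal_add_less_top ennreal_less_top infinity_ennreal_def simp_thms)
  qed
  finally show ?thesis .
qed

theorem corollary5p21:
  fixes p :: "real \<Rightarrow> real" and K :: real and f :: "nat \<Rightarrow> real \<Rightarrow> real"
  assumes "p \<in> borel_measurable unit_leb"
    and "\<And>x. x \<in> {0..<1} \<Longrightarrow> 0 < p x"
    and "0 < p_minus p {0..<1}"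
    and "p_minus p {0..<1} \<le> p_plus p {0..<1}"
    and "p_plus p {0..<1} < \<infinity>"
    and "1 \<le> K"
    and "\<And>n k. k < 2 ^ n \<Longrightarrow>
           measure unit_leb (dyadic_interval n k) powr
             real_of_ereal (p_minus p (dyadic_interval n k) - p_plus p (dyadic_interval n k)) \<le> K"
    and "1 / p_minus p {0..<1} - 1 / p_plus p {0..<1} < 1"
    and "1 / 2 < p_minus p {0..<1}"
    and "p_minus p {0..<1} < \<infinity>"
    and "f \<in> hardy_space p"
  shows "AE x in unit_leb. convergent (\<lambda>n. fejer_mean f n x)"
proof -
  obtain q where q: "1 / 2 < q" "q \<le> 1" "AE x in unit_leb. q \<le> p x"
    using p_minus_lower_exponent[OF assms(9)] .
  have f: "tree_martingale f"
    using assms(11) by (intro tree_martingale_of_dyadic_martingale) (simp add: hardy_space_def)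
  have "(\<integral>\<^sup>+x. (SUP n. ennreal (\<bar>f n x\<bar> powr q)) \<partial>unit_leb) < \<infinity>"
    using q by (intro hardy_space_powr_integral[OF assms(1,11)]) auto
  then show ?thesis by (rule AE_convergent_fejer_mean[OF f q(1,2)])
qed

end
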